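(* Let $\mathcal U,\mathcal Y$ be separable Hilbert spaces and let $\theta$ be a function holomorphic on some neighbourhood $\Gamma$ of $z=0$ in $\mathbb C^N$, with values in $[\mathcal U,\mathcal Y]$, having a zero of multiplicity $m=m(\theta)>0$ at $z=0$. Then there exist separable Hilbert spaces $\mathcal Y^{(0)}=\mathcal Y,\mathcal Y^{(1)},\dots,\mathcal Y^{(m)}$, operators $L^{(j)}_k\in[\mathcal Y^{(j)},\mathcal Y^{(j-1)}]$ ($j=1,\dots,m$; $k=1,\dots,N$), and a function $\phi$ holomorphic on some neighbourhood of $z=0$ with values in $[\mathcal U,\mathcal Y^{(m)}]$ and $\phi(0)\neq 0$, such that $$\theta(z)=z\mathbf L^{(1)}\,z\mathbf L^{(2)}\cdots z\mathbf L^{(m)}\,\phi(z)$$ holds on some neighbourhood (possibly smaller than $\Gamma$) of $z=0$.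
   Context: $[\mathcal U,\mathcal Y]$ denotes the Banach space of bounded linear operators from $\mathcal U$ to $\mathcal Y$. For an $N$-tuple $\mathbf T=(T_1,\dots,T_N)$ of operators and $z=(z_1,\dots,z_N)\in\mathbb C^N$, $z\mathbf T:=\sum_{k=1}^N z_kT_k$. A function $\theta$ holomorphic near $z=0$, not vanishing identically near $0$, has a zero of multiplicity $m$ at $z=0$ if, in its expansion $\theta(z)=\sum_{n\ge0}\theta_n(z)$ into homogeneous polynomials $\theta_n$ of degree $n$, one has $\theta_n\equiv0$ for $n<m$ and $\theta_m\not\equiv 0$. *)

theory Defs
  imports "HOL-Analysis.Analysis"
begin

text \<open>Complex Hilbert spaces.  The library has only real inner product spaces, so a
  complex Hilbert space is a real Hilbert space (class real_inner + complete_space, which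
  fixes the norm and completeness) carrying a complex scalar multiplication and a complex
  inner product (linear in the second argument) whose real part is the real inner product.\<close>

class complex_hilbert = real_inner + complete_space +
  fixes cscale :: "complex \<Rightarrow> 'a \<Rightarrow> 'a" (infixr \<open>*\<^sub>C\<close> 75)
  fixes cinner :: "'a \<Rightarrow> 'a \<Rightarrow> complex"
  assumes cscale_add_right: "a *\<^sub>C (x + y) = a *\<^sub>C x + a *\<^sub>C y"
    and cscale_add_left: "(a + b) *\<^sub>C x = a *\<^sub>C x + b *\<^sub>C x"
    and cscale_cscale: "a *\<^sub>C (b *\<^sub>C x) = (a * b) *\<^sub>C x"
    and cscale_one: "1 *\<^sub>C x = x"
    and cscale_of_real: "complex_of_real r *\<^sub>C x = r *\<^sub>R x"
    and cinner_add_right: "cinner x (y + z) = cinner x y + cinner x z"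
    and cinner_cscale_right: "cinner x (a *\<^sub>C y) = a * cinner x y"
    and cinner_commute: "cinner y x = cnj (cinner x y)"
    and inner_cinner: "inner x y = Re (cinner x y)"

definition clinear_op :: "('a::complex_hilbert \<Rightarrow>\<^sub>L 'b::complex_hilbert) \<Rightarrow> bool" where
  "clinear_op T \<longleftrightarrow> (\<forall>c x. blinfun_apply T (c *\<^sub>C x) = c *\<^sub>C blinfun_apply T x)"

definition cscaleL :: "complex \<Rightarrow> ('a::real_normed_vector \<Rightarrow>\<^sub>L 'b::complex_hilbert) \<Rightarrow> ('a \<Rightarrow>\<^sub>L 'b)" where
  "cscaleL c T = Blinfun (\<lambda>u. c *\<^sub>C blinfun_apply T u)"

definition cholomorphic_on ::
  "(complex^'n \<Rightarrow> ('a::real_normed_vector \<Rightarrow>\<^sub>L 'b::complex_hilbert)) \<Rightarrow> (complex^'n) set \<Rightarrow> bool" where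
  "cholomorphic_on f S \<longleftrightarrow> (\<forall>z\<in>S. \<exists>D. (f has_derivative D) (at z) \<and>
      (\<forall>w u. blinfun_apply (D (\<i> *s w)) u = \<i> *\<^sub>C blinfun_apply (D w) u))"

definition hom_poly ::
  "(complex^'n::finite \<Rightarrow> ('a::complex_hilbert \<Rightarrow>\<^sub>L 'b::complex_hilbert)) \<Rightarrow> nat \<Rightarrow> bool" where
  "hom_poly P n \<longleftrightarrow> (\<exists>A. (\<forall>\<alpha>. clinear_op (A \<alpha>)) \<and>
      (\<forall>z. P z = (\<Sum>\<alpha>\<in>{\<alpha>::'n \<Rightarrow> nat. sum \<alpha> UNIV = n}. cscaleL (\<Prod>k\<in>UNIV. (z $ k) ^ \<alpha> k) (A \<alpha>))))"

definition zero_multiplicity ::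
  "(complex^'n::finite \<Rightarrow> ('a::complex_hilbert \<Rightarrow>\<^sub>L 'b::complex_hilbert)) \<Rightarrow> nat \<Rightarrow> bool" where
  "zero_multiplicity \<theta> m \<longleftrightarrow> (\<exists>P. (\<forall>n. hom_poly (P n) n) \<and>
      (\<exists>r>0. \<forall>z. norm z < r \<longrightarrow> (\<lambda>n. P n z) sums \<theta> z) \<and>
      (\<forall>n<m. \<forall>z. P n z = 0) \<and> (\<exists>z. P m z \<noteq> 0))"

definition zL :: "('n::finite \<Rightarrow> ('a::real_normed_vector \<Rightarrow>\<^sub>L 'b::complex_hilbert)) \<Rightarrow> complex^'n \<Rightarrow> ('a \<Rightarrow>\<^sub>L 'b)" where
  "zL T z = (\<Sum>k\<in>UNIV. cscaleL (z $ k) (T k))"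

primrec opprod :: "(nat \<Rightarrow> ('a::real_normed_vector \<Rightarrow>\<^sub>L 'a)) \<Rightarrow> nat \<Rightarrow> ('a \<Rightarrow>\<^sub>L 'a)" where
  "opprod A 0 = id_blinfun"
| "opprod A (Suc n) = opprod A n o\<^sub>L A (Suc n)"

end

theory Submission
  imports Defs "HOL-Complex_Analysis.Complex_Analysis"
begin

text \<open>
  The Taylor coefficients of \<open>\<theta>\<close> satisfy Cauchy estimates, so for small weights they can be stored
  in one bounded operator \<open>T\<close> from \<open>'u\<close> to a Fock space over \<open>'y\<close>, realised inside the given
  infinite-dimensional space by isometries \<open>V\<^sub>k\<close> and \<open>J\<close> with mutually orthogonal ranges. With the
  rescaled adjoint shifts \<open>S\<^sub>k\<close> and the vacuum projection \<open>C\<close> this gives \<open>C (z S)\<^sup>n T = \<theta>\<^sub>n(z)\<close> for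
  all \<open>n\<close>. Since \<open>\<theta>\<^sub>n = 0\<close> for \<open>n < m\<close>, summing over \<open>n\<close> yields
  \<open>\<theta>(z) = C (z S)\<^sup>m (1 - z S)\<^sup>-\<^sup>1 T\<close>, so \<open>\<phi>(z) = (1 - z S)\<^sup>-\<^sup>1 T\<close> works, and \<open>\<phi>(0) = T\<close> is nonzero
  because \<open>\<theta>\<^sub>m\<close> is.
\<close>

no_notation fps_nth (infixl \<open>$\<close> 75)

section \<open>Complex Hilbert spaces\<close>

instance complex_hilbert \<subseteq> banach ..

lemma cscale_zero_left [simp]: "0 *\<^sub>C (x::'a::complex_hilbert) = 0"
  using cscale_of_real[of 0 x] by simp

lemma cscale_zero_right [simp]: "c *\<^sub>C (0::'a::complex_hilbert) = 0"
  using cscale_add_right[of c "0::'a" 0] by simp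

lemma cinner_zero_right [simp]: "cinner (x::'a::complex_hilbert) 0 = 0"
  using cinner_add_right[of x 0 0] by simp

lemma cinner_zero_left [simp]: "cinner 0 (x::'a::complex_hilbert) = 0"
  using cinner_commute[of 0 x] by simp

lemma cinner_cscale_left: "cinner (a *\<^sub>C x) (z::'a::complex_hilbert) = cnj a * cinner x z"
  by (metis cinner_cscale_right cinner_commute complex_cnj_mult)

lemma cinner_scaleR_right: "cinner x (r *\<^sub>R (y::'a::complex_hilbert)) = of_real r * cinner x y"
  by (metis cinner_cscale_right cscale_of_real)

lemma cinner_minus_right: "cinner x (- (y::'a::complex_hilbert)) = - cinner x y"
  using cinner_scaleR_right[of x "-1" y] by simp

lemma cinner_diff_right: "cinner x (y - (z::'a::complex_hilbert)) = cinner x y - cinner x z"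
  using cinner_add_right[of x y "-z"] by (simp add: cinner_minus_right)

lemma cinner_sum_right: "cinner x (sum f A) = (\<Sum>i\<in>A. cinner x (f i :: 'a::complex_hilbert))"
  by (induction A rule: infinite_finite_induct) (auto simp: cinner_add_right)

lemma cinner_self: "cinner x (x::'a::complex_hilbert) = of_real ((norm x)\<^sup>2)"
proof (rule complex_eqI)
  show "Im (cinner x x) = Im (of_real ((norm x)\<^sup>2))"
    using cinner_commute[of x x] by (metis Im_complex_of_real Reals_cnj_iff complex_is_Real_iff)
qed (simp add: inner_cinner[symmetric] power2_norm_eq_inner)

lemma norm_cscale [simp]: "norm (c *\<^sub>C (x::'a::complex_hilbert)) = norm c * norm x"
proof -
  have "of_real ((norm (c *\<^sub>C x))\<^sup>2) = cnj c * c * of_real ((norm x)\<^sup>2)"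
    by (simp only: cinner_self[symmetric] cinner_cscale_left cinner_cscale_right ac_simps)
  also have "\<dots> = of_real ((norm c)\<^sup>2) * of_real ((norm x)\<^sup>2)"
    by (simp only: complex_norm_square mult.commute)
  also have "\<dots> = of_real ((norm c * norm x)\<^sup>2)"
    by (simp add: power_mult_distrib)
  finally have "(norm (c *\<^sub>C x))\<^sup>2 = (norm c * norm x)\<^sup>2"
    using of_real_eq_iff by blast
  then show ?thesis
    by (simp add: power2_eq_iff_nonneg)
qed

lemma cscale_scaleR: "c *\<^sub>C (r *\<^sub>R (x::'a::complex_hilbert)) = r *\<^sub>R (c *\<^sub>C x)"
  by (metis cscale_cscale cscale_of_real mult.commute)

lemma bounded_linear_cscale: "bounded_linear (\<lambda>x::'a::complex_hilbert. c *\<^sub>C x)"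
  by (rule bounded_linear_intro[where K = "norm c"])
     (simp_all add: cscale_add_right cscale_scaleR)

lemma bounded_linear_cscale_left: "bounded_linear (\<lambda>c. c *\<^sub>C (x::'a::complex_hilbert))"
proof (rule bounded_linear_intro[where K = "norm x"])
  fix r :: real and c
  show "(r *\<^sub>R c) *\<^sub>C x = r *\<^sub>R (c *\<^sub>C x)"
    by (metis cscale_cscale cscale_of_real scaleR_conv_of_real)
qed (simp_all add: cscale_add_left)

lemma cscale_sum_right: "c *\<^sub>C (sum f A) = (\<Sum>i\<in>A. c *\<^sub>C (f i :: 'a::complex_hilbert))"
  using linear_sum[OF bounded_linear.linear[OF bounded_linear_cscale], of c f A] by simp

lemma norm_cinner_le: "norm (cinner x (y::'a::complex_hilbert)) \<le> norm x * norm y"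
proof -
  \<comment> \<open>A unimodular rotation that makes the inner product real and nonnegative, so that
    the real Cauchy-Schwarz inequality applies. If the inner product is 0 then \<open>c\<close> is
    0, hence only \<open>norm c \<le> 1\<close>.\<close>
  define c where "c = cnj (sgn (cinner x y))"
  have c: "norm c \<le> 1"
    by (simp add: c_def norm_sgn)
  have "cinner x (c *\<^sub>C y) = of_real (norm (cinner x y))"
  proof (cases "cinner x y = 0")
    case False
    then show ?thesis
      by (simp add: c_def cinner_cscale_right sgn_div_norm divide_simps scaleR_conv_of_real mult.commute
          complex_norm_square[symmetric] power2_eq_square)
  qed (simp add: cinner_cscale_right)
  then have "norm (cinner x y) = inner x (c *\<^sub>C y)"
    by (simp add: inner_cinner)
  also have "\<dots> \<le> norm x * (norm c * norm y)"
    using norm_cauchy_schwarz[of x "c *\<^sub>C y"] by simp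
  also have "\<dots> \<le> norm x * (1 * norm y)"
    using c by (intro mult_left_mono mult_right_mono) auto
  finally show ?thesis by simp
qed

lemma bounded_linear_cinner_right: "bounded_linear (cinner (x::'a::complex_hilbert))"
  by (rule bounded_linear_intro[where K = "norm x"])
     (simp_all add: cinner_add_right cinner_scaleR_right scaleR_conv_of_real
       mult.commute[of _ "norm x"] norm_cinner_le)

section \<open>Orthonormal sequences and partial isometries\<close>

definition orthonormal_or_zero :: "(nat \<Rightarrow> 'a::complex_hilbert) \<Rightarrow> bool" where
  "orthonormal_or_zero a \<longleftrightarrow>
     (\<forall>i j. i \<noteq> j \<longrightarrow> cinner (a i) (a j) = 0) \<and> (\<forall>i. a i = 0 \<or> norm (a i) = 1)"

lemma norm_add_orthogonal:
  assumes "cinner x (y::'a::complex_hilbert) = 0"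
  shows "(norm (x + y))\<^sup>2 = (norm x)\<^sup>2 + (norm y)\<^sup>2"
proof -
  have "inner x y = 0" using assms by (simp add: inner_cinner)
  then show ?thesis
    by (simp add: power2_norm_eq_inner inner_add_left inner_add_right inner_commute)
qed

lemma orthonormal_or_zero_norm_sum:
  assumes "orthonormal_or_zero b" "finite F"
  shows "(norm (\<Sum>i\<in>F. c i *\<^sub>C b i))\<^sup>2 \<le> (\<Sum>i\<in>F. (norm (c i))\<^sup>2)"
  using assms(2)
proof (induction F)
  case (insert i F)
  have "cinner (c i *\<^sub>C b i) (\<Sum>i\<in>F. c i *\<^sub>C b i) = 0"
    using insert.hyps assms(1)
    by (auto simp: cinner_sum_right cinner_cscale_right cinner_cscale_left orthonormal_or_zero_def
        intro!: sum.neutral) metis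
  moreover have "norm (b i) \<le> 1"
    using assms(1) by (metis norm_zero order.refl orthonormal_or_zero_def zero_le_one)
  then have "(norm (c i *\<^sub>C b i))\<^sup>2 \<le> (norm (c i))\<^sup>2"
    by (intro power_mono) (auto simp: mult_left_le)
  ultimately show ?case
    using insert by (simp add: norm_add_orthogonal add_mono del: norm_cscale power2_le_iff_abs_le power_mono_iff abs_le_square_iff)
qed simp

lemma orthonormal_or_zero_cinner_sum:
  assumes "orthonormal_or_zero a" "finite F" "i \<in> F"
  shows "cinner (a i) (\<Sum>j\<in>F. c j *\<^sub>C a j) = c i * of_real ((norm (a i))\<^sup>2)"
proof -
  have "cinner (a i) (\<Sum>j\<in>F. c j *\<^sub>C a j) = (\<Sum>j\<in>F. if j = i then c i * of_real ((norm (a i))\<^sup>2) else 0)"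
    unfolding cinner_sum_right cinner_cscale_right using assms(1)
    by (intro sum.cong) (auto simp: orthonormal_or_zero_def cinner_self)
  then show ?thesis using assms by simp
qed

text \<open>The remainder is orthogonal to every \<open>a i\<close> and hence to the projection
  \<open>p\<close>, whose squared norm is the sum of the squared coefficients. A zero entry has
  coefficient 0 and does not disturb this.\<close>

lemma orthonormal_or_zero_pythagoras:
  assumes "orthonormal_or_zero a" "finite F"
  shows "(norm (x - (\<Sum>i\<in>F. cinner (a i) x *\<^sub>C a i)))\<^sup>2 + (\<Sum>i\<in>F. (norm (cinner (a i) x))\<^sup>2) = (norm x)\<^sup>2"
proof -
  define p where "p = (\<Sum>i\<in>F. cinner (a i) x *\<^sub>C a i)"
  have *: "cinner (a i) (x - p) = 0" if "i \<in> F" for i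
  proof -
    have "a i = 0 \<or> norm (a i) = 1" using assms(1) by (simp add: orthonormal_or_zero_def)
    then show ?thesis
      using orthonormal_or_zero_cinner_sum[OF assms that, of "\<lambda>i. cinner (a i) x"]
      by (auto simp: cinner_diff_right p_def)
  qed
  have "cinner (x - p) p = 0"
    unfolding p_def cinner_sum_right cinner_cscale_right
    using * by (intro sum.neutral) (metis cinner_commute complex_cnj_zero mult_zero_right p_def)
  then have 1: "(norm x)\<^sup>2 = (norm (x - p))\<^sup>2 + (norm p)\<^sup>2"
    using norm_add_orthogonal[of "x - p" p] by simp
  have "of_real ((norm p)\<^sup>2) = cinner p p" by (simp add: cinner_self)
  also have "\<dots> = (\<Sum>i\<in>F. cinner (a i) x * cinner p (a i))"
    unfolding p_def by (subst cinner_sum_right) (simp only: cinner_cscale_right)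
  also have "\<dots> = (\<Sum>i\<in>F. of_real ((norm (cinner (a i) x))\<^sup>2))"
  proof (intro sum.cong refl)
    fix i assume "i \<in> F"
    then have "cinner (a i) p = cinner (a i) x"
      using * by (simp add: cinner_diff_right)
    then have "cinner p (a i) = cnj (cinner (a i) x)" by (metis cinner_commute)
    then show "cinner (a i) x * cinner p (a i) = of_real ((norm (cinner (a i) x))\<^sup>2)"
      by (simp add: complex_norm_square[symmetric])
  qed
  finally have "(norm p)\<^sup>2 = (\<Sum>i\<in>F. (norm (cinner (a i) x))\<^sup>2)"
    by (metis of_real_eq_iff of_real_sum)
  then show ?thesis using 1 by (simp add: p_def)
qed

lemma bessel_inequality:
  assumes "orthonormal_or_zero a" "finite F"
  shows "(\<Sum>i\<in>F. (norm (cinner (a i) x))\<^sup>2) \<le> (norm x)\<^sup>2"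
  using orthonormal_or_zero_pythagoras[OF assms, of x] by (smt (verit) zero_le_power2)

text \<open>Bessel makes the squared coefficients summable, and the norm bound along
  \<open>b\<close> carries their Cauchy criterion over to the vectors.\<close>

lemma summable_orthonormal_or_zero:
  assumes a: "orthonormal_or_zero a" and b: "orthonormal_or_zero b"
  shows "summable (\<lambda>i. cinner (a i) x *\<^sub>C b i)"
  unfolding summable_Cauchy
proof (intro allI impI)
  fix e :: real assume "e > 0"
  have "summable (\<lambda>i. (norm (cinner (a i) x))\<^sup>2)"
    by (rule bounded_imp_summable[where B = "(norm x)\<^sup>2"]) (auto intro: bessel_inequality[OF a])
  then obtain N where N: "\<And>m n. m \<ge> N \<Longrightarrow> norm (\<Sum>i=m..<n. (norm (cinner (a i) x))\<^sup>2) < e\<^sup>2"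
    using \<open>e > 0\<close> unfolding summable_Cauchy by (meson zero_less_power)
  have "norm (\<Sum>i=m..<n. cinner (a i) x *\<^sub>C b i) < e" if "m \<ge> N" for m n
  proof -
    have "(norm (\<Sum>i=m..<n. cinner (a i) x *\<^sub>C b i))\<^sup>2 < e\<^sup>2"
      using orthonormal_or_zero_norm_sum[OF b, of "{m..<n}" "\<lambda>i. cinner (a i) x"] N[OF that, of n] by simp
    then show ?thesis using \<open>e > 0\<close> by (simp add: power2_less_imp_less)
  qed
  then show "\<exists>N. \<forall>m\<ge>N. \<forall>n. norm (\<Sum>i=m..<n. cinner (a i) x *\<^sub>C b i) < e" by blast
qed

text \<open>The map taking \<open>a i\<close> to \<open>b i\<close> and vanishing on the orthogonal
  complement of the \<open>a i\<close>. An index where either family is 0 contributes nothing.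
  Exchanging \<open>a\<close> and \<open>b\<close> gives the adjoint, which is how
  \<open>S k\<close> and \<open>C\<close> arise from \<open>V k\<close> and \<open>J\<close>
  later.\<close>

definition partial_isom :: "(nat \<Rightarrow> 'a::complex_hilbert) \<Rightarrow> (nat \<Rightarrow> 'b::complex_hilbert) \<Rightarrow> 'a \<Rightarrow>\<^sub>L 'b" where
  "partial_isom a b = Blinfun (\<lambda>x. \<Sum>i. cinner (a i) x *\<^sub>C b i)"

context
  fixes a :: "nat \<Rightarrow> 'a::complex_hilbert" and b :: "nat \<Rightarrow> 'b::complex_hilbert"
  assumes a: "orthonormal_or_zero a" and b: "orthonormal_or_zero b"
begin

lemma norm_orthonormal_series_le: "norm (\<Sum>i. cinner (a i) x *\<^sub>C b i) \<le> norm x"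
proof -
  have "norm (\<Sum>i<n. cinner (a i) x *\<^sub>C b i) \<le> norm x" for n
  proof (rule power2_le_imp_le)
    show "(norm (\<Sum>i<n. cinner (a i) x *\<^sub>C b i))\<^sup>2 \<le> (norm x)\<^sup>2"
      using orthonormal_or_zero_norm_sum[OF b finite_lessThan] bessel_inequality[OF a finite_lessThan]
      by (rule order_trans)
  qed simp
  then show ?thesis
    using LIMSEQ_le_const2[OF tendsto_norm[OF summable_LIMSEQ[OF summable_orthonormal_or_zero[OF a b]]]]
    by blast
qed

lemma partial_isom_apply: "blinfun_apply (partial_isom a b) x = (\<Sum>i. cinner (a i) x *\<^sub>C b i)"
proof -
  note s = summable_orthonormal_or_zero[OF a b]
  have "bounded_linear (\<lambda>x. \<Sum>i. cinner (a i) x *\<^sub>C b i)"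
  proof (rule bounded_linear_intro[where K = 1])
    fix x y
    show "(\<Sum>i. cinner (a i) (x + y) *\<^sub>C b i) = (\<Sum>i. cinner (a i) x *\<^sub>C b i) + (\<Sum>i. cinner (a i) y *\<^sub>C b i)"
      using suminf_add[OF s s, of x y] by (simp add: cinner_add_right cscale_add_left)
  next
    fix r x
    show "(\<Sum>i. cinner (a i) (r *\<^sub>R x) *\<^sub>C b i) = r *\<^sub>R (\<Sum>i. cinner (a i) x *\<^sub>C b i)"
      using suminf_scaleR_right[OF s, of r x]
      by (simp add: cinner_scaleR_right cscale_cscale[symmetric] cscale_of_real)
  qed (simp add: norm_orthonormal_series_le)
  then show ?thesis by (simp add: partial_isom_def bounded_linear_Blinfun_apply)
qed

lemma norm_partial_isom_le: "norm (partial_isom a b) \<le> 1"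
  by (rule norm_blinfun_bound) (simp_all add: partial_isom_apply norm_orthonormal_series_le)

lemma clinear_op_partial_isom: "clinear_op (partial_isom a b)"
  unfolding clinear_op_def
proof (intro allI)
  fix c x
  show "blinfun_apply (partial_isom a b) (c *\<^sub>C x) = c *\<^sub>C blinfun_apply (partial_isom a b) x"
    using bounded_linear.suminf[OF bounded_linear_cscale summable_orthonormal_or_zero[OF a b], of c x]
    by (simp add: partial_isom_apply cinner_cscale_right cscale_cscale)
qed

lemma partial_isom_eq:
  assumes "norm (a i) = 1"
  shows "blinfun_apply (partial_isom a b) (a i) = b i"
proof -
  have "(\<Sum>j. cinner (a j) (a i) *\<^sub>C b j) = (\<Sum>j\<in>{i}. cinner (a j) (a i) *\<^sub>C b j)"
    using a by (intro suminf_finite) (auto simp: orthonormal_or_zero_def)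
  then show ?thesis using assms by (simp add: partial_isom_apply cinner_self cscale_one)
qed

lemma partial_isom_eq_0:
  assumes "\<And>i. cinner (a i) x = 0"
  shows "blinfun_apply (partial_isom a b) x = 0"
  using assms by (simp add: partial_isom_apply)

end

section \<open>Gram-Schmidt and orthonormal bases of separable spaces\<close>

fun gram_schmidt :: "(nat \<Rightarrow> 'a::complex_hilbert) \<Rightarrow> nat \<Rightarrow> 'a" where
  "gram_schmidt d n = sgn (d n - sum_list (map (\<lambda>j. cinner (gram_schmidt d j) (d n) *\<^sub>C gram_schmidt d j) [0..<n]))"

declare gram_schmidt.simps [simp del]

lemma gram_schmidt_eq:
  "gram_schmidt d n = sgn (d n - (\<Sum>j<n. cinner (gram_schmidt d j) (d n) *\<^sub>C gram_schmidt d j))"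
  by (subst gram_schmidt.simps) (simp add: interv_sum_list_conv_sum_set_nat atLeast0LessThan)

text \<open>Strong induction: subtracting the components along the earlier vectors leaves a
  remainder orthogonal to them. \<open>sgn\<close> normalises a nonzero remainder and sends 0 to 0,
  so dependent entries become zero vectors instead of being skipped.\<close>

lemma orthonormal_or_zero_gram_schmidt: "orthonormal_or_zero (gram_schmidt d)"
proof -
  define g where "g = gram_schmidt d"
  have nrm: "g n = 0 \<or> norm (g n) = 1" for n
    unfolding g_def by (subst (1 2) gram_schmidt_eq) (simp add: norm_sgn sgn_zero_iff)
  have orth: "\<forall>i<n. cinner (g i) (g n) = 0" for n
  proof (induction n rule: less_induct)
    case (less n)
    define r where "r = d n - (\<Sum>j<n. cinner (g j) (d n) *\<^sub>C g j)"
    have "cinner (g i) r = 0" if "i < n" for i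
    proof -
      have "cinner (g i) (g j) = 0" if "j < n" "j \<noteq> i" for j
        using less \<open>i < n\<close> that by (metis cinner_commute complex_cnj_zero nat_neq_iff)
      then have "(\<Sum>j<n. cinner (g j) (d n) * cinner (g i) (g j))
          = (\<Sum>j<n. if j = i then cinner (g i) (d n) * of_real ((norm (g i))\<^sup>2) else 0)"
        by (intro sum.cong) (auto simp: cinner_self)
      also have "\<dots> = cinner (g i) (d n)"
        using nrm[of i] that by auto
      finally show ?thesis
        by (simp add: r_def cinner_diff_right cinner_sum_right cinner_cscale_right)
    qed
    moreover have "g n = sgn r"
      unfolding g_def r_def by (rule gram_schmidt_eq)
    ultimately show ?case by (simp add: sgn_div_norm cinner_scaleR_right)
  qed
  have "cinner (g i) (g j) = 0" if "i \<noteq> j" for i j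
    using orth that by (metis cinner_commute complex_cnj_zero nat_neq_iff)
  then show ?thesis using nrm by (auto simp: orthonormal_or_zero_def g_def)
qed

text \<open>The partial sum \<open>p n\<close> is the orthogonal projection onto the first n vectors
  and fixes \<open>d k\<close> for k < n. Hence \<open>x - p n x\<close> is the remainder of
  \<open>x - d k\<close>, whose norm is at most that of \<open>x - d k\<close>, and density of
  \<open>d\<close> makes this small.\<close>

lemma gram_schmidt_sums:
  assumes dense: "closure (range d) = (UNIV :: 'a::complex_hilbert set)"
  shows "(\<lambda>j. cinner (gram_schmidt d j) x *\<^sub>C gram_schmidt d j) sums x"
proof -
  define g where "g = gram_schmidt d"
  have o: "orthonormal_or_zero g"
    by (simp add: g_def orthonormal_or_zero_gram_schmidt)
  define p where "p n x = (\<Sum>j<n. cinner (g j) x *\<^sub>C g j)" for n x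
  have p_add: "p n (x + y) = p n x + p n y" for n x y
    by (simp add: p_def cinner_add_right cscale_add_left sum.distrib)
  have p_cscale: "p n (c *\<^sub>C x) = c *\<^sub>C p n x" for n c x
    by (simp add: p_def cinner_cscale_right cscale_cscale cscale_sum_right)
  have p_sum: "p n (sum f A) = (\<Sum>i\<in>A. p n (f i))" for n A and f :: "nat \<Rightarrow> 'a"
    by (induction A rule: infinite_finite_induct) (auto simp: p_add, auto simp: p_def)
  have p_g: "p n (g i) = g i" if "i < n" for n i
  proof -
    have "p n (g i) = (\<Sum>j<n. if j = i then cinner (g i) (g i) *\<^sub>C g i else 0)"
      unfolding p_def using o by (intro sum.cong) (auto simp: orthonormal_or_zero_def)
    then show ?thesis
      using that o by (auto simp: cinner_self orthonormal_or_zero_def cscale_one)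
        (metis cscale_one cscale_zero_right norm_zero one_power2 of_real_1)
  qed
  have p_d: "p n (d k) = d k" if "k < n" for n k
  proof -
    define r where "r = d k - (\<Sum>j<k. cinner (g j) (d k) *\<^sub>C g j)"
    have "g k = sgn r"
      unfolding g_def r_def by (rule gram_schmidt_eq)
    then have "r = of_real (norm r) *\<^sub>C g k"
      by (cases "r = 0") (simp_all add: cscale_of_real sgn_div_norm)
    then have d: "d k = of_real (norm r) *\<^sub>C g k + (\<Sum>j<k. cinner (g j) (d k) *\<^sub>C g j)"
      by (metis r_def diff_add_cancel)
    have "p n (d k) = of_real (norm r) *\<^sub>C g k + (\<Sum>j<k. cinner (g j) (d k) *\<^sub>C p n (g j))"
      by (subst d) (use that in \<open>simp only: p_add p_sum p_cscale p_g\<close>)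
    also have "(\<Sum>j<k. cinner (g j) (d k) *\<^sub>C p n (g j)) = (\<Sum>j<k. cinner (g j) (d k) *\<^sub>C g j)"
      using that by (intro sum.cong) (auto simp: p_g)
    finally show ?thesis using d by simp
  qed
  have "(\<lambda>n. p n x) \<longlonglongrightarrow> x"
  proof (rule LIMSEQ_I)
    fix e :: real assume "e > 0"
    obtain k where k: "dist (d k) x < e"
      using dense \<open>e > 0\<close> closure_approachable[of x "range d"] by auto
    have "norm (p n x - x) < e" if "n > k" for n
    proof -
      have "x - p n x = (x - d k) - p n (x - d k)"
        using p_add[of n "x - d k" "d k"] p_d[OF that] by simp
      moreover have "norm ((x - d k) - p n (x - d k)) \<le> norm (x - d k)"
      proof (rule power2_le_imp_le)
        have "(\<Sum>i<n. (norm (cinner (g i) (x - d k)))\<^sup>2) \<ge> 0" by (simp add: sum_nonneg)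
        then show "(norm (x - d k - p n (x - d k)))\<^sup>2 \<le> (norm (x - d k))\<^sup>2"
          using orthonormal_or_zero_pythagoras[OF o finite_lessThan[of n], of "x - d k"] unfolding p_def by linarith
      qed simp
      ultimately show ?thesis
        using k by (metis dist_norm norm_minus_commute order.strict_trans1)
    qed
    then show "\<exists>N. \<forall>n\<ge>N. norm (p n x - x) < e"
      by (metis Suc_le_lessD)
  qed
  then show ?thesis
    by (simp add: sums_def p_def g_def)
qed

lemma separable_space_dense_sequence:
  assumes "separable_space (euclidean :: 'a::topological_space topology)"
  shows "\<exists>d :: nat \<Rightarrow> 'a::topological_space. closure (range d) = UNIV"
proof -
  obtain C :: "'a set" where C: "countable C" "closure C = UNIV"
    using assms unfolding separable_space_def by auto
  then have "C \<noteq> {}" by auto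
  then have "range (from_nat_into C) = C"
    using C by (simp add: range_from_nat_into)
  then show ?thesis using C by metis
qed

definition total_seq :: "(nat \<Rightarrow> 'a::complex_hilbert) \<Rightarrow> bool" where
  "total_seq f \<longleftrightarrow> (\<forall>x. (\<lambda>j. cinner (f j) x *\<^sub>C f j) sums x)"

lemma ex_total_orthonormal_or_zero:
  assumes "separable_space (euclidean :: 'a::complex_hilbert topology)"
  shows "\<exists>f :: nat \<Rightarrow> 'a::complex_hilbert. orthonormal_or_zero f \<and> total_seq f"
proof -
  obtain d :: "nat \<Rightarrow> 'a" where "closure (range d) = UNIV"
    using separable_space_dense_sequence[OF assms] by blast
  then show ?thesis
    using gram_schmidt_sums orthonormal_or_zero_gram_schmidt unfolding total_seq_def by blast
qed

lemma clinear_op_eqI: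
  assumes "total_seq f" "clinear_op A" "clinear_op B"
    and eq: "\<And>j. blinfun_apply A (f j) = blinfun_apply B (f j)"
  shows "A = B"
proof (rule blinfun_eqI)
  fix x
  have s: "(\<lambda>j. cinner (f j) x *\<^sub>C f j) sums x"
    using assms by (simp add: total_seq_def)
  have "(\<lambda>j. blinfun_apply A (cinner (f j) x *\<^sub>C f j)) sums blinfun_apply A x"
    by (rule bounded_linear.sums[OF blinfun.bounded_linear_right s])
  moreover have "(\<lambda>j. blinfun_apply B (cinner (f j) x *\<^sub>C f j)) sums blinfun_apply B x"
    by (rule bounded_linear.sums[OF blinfun.bounded_linear_right s])
  ultimately show "blinfun_apply A x = blinfun_apply B x"
    using assms by (metis (no_types, lifting) clinear_op_def sums_cong sums_unique2)
qed

text \<open>Infinite dimension forces infinitely many nonzero entries in the total family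
  \<open>f\<close>; enumerating them gives the genuine unit vectors \<open>e\<close>. Totality stays
  with \<open>f\<close>, and the range inclusion transfers it to \<open>e\<close>.\<close>

lemma ex_orthonormal_basis:
  assumes "separable_space (euclidean :: 'a::complex_hilbert topology)"
    and inf: "\<not> (\<exists>B. finite B \<and> span B = (UNIV :: 'a set))"
  shows "\<exists>e f :: nat \<Rightarrow> 'a::complex_hilbert. orthonormal_or_zero e \<and> (\<forall>i. norm (e i) = 1) \<and>
           total_seq f \<and> range f \<subseteq> insert 0 (range e)"
proof -
  obtain f :: "nat \<Rightarrow> 'a" where f: "orthonormal_or_zero f" "total_seq f"
    using ex_total_orthonormal_or_zero[OF assms(1)] by metis
  define I where "I = {i. f i \<noteq> 0}"
  have "infinite I"
  proof
    assume "finite I"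
    \<comment> \<open>\<open>span\<close> is the real span, so the multiples by \<open>\<i>\<close>
      have to be added as generators.\<close>
    define B where "B = f ` I \<union> (\<lambda>i. \<i> *\<^sub>C f i) ` I"
    have "x \<in> span B" for x
    proof -
      have "(\<lambda>j. cinner (f j) x *\<^sub>C f j) sums x"
        using f by (simp add: total_seq_def)
      moreover have "(\<lambda>j. cinner (f j) x *\<^sub>C f j) sums (\<Sum>j\<in>I. cinner (f j) x *\<^sub>C f j)"
        by (rule sums_finite) (use \<open>finite I\<close> in \<open>auto simp: I_def\<close>)
      ultimately have x: "x = (\<Sum>j\<in>I. cinner (f j) x *\<^sub>C f j)"
        by (rule sums_unique2)
      have "c *\<^sub>C f j \<in> span B" if "j \<in> I" for c j
      proof -
        have "c *\<^sub>C f j = (of_real (Re c) + of_real (Im c) * \<i>) *\<^sub>C f j"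
          by (metis complex_eq mult.commute)
        also have "\<dots> = Re c *\<^sub>R f j + Im c *\<^sub>R (\<i> *\<^sub>C f j)"
          by (simp add: cscale_add_left cscale_cscale[symmetric] cscale_of_real)
        also have "\<dots> \<in> span B"
          by (intro span_add span_scale span_base) (use that in \<open>auto simp: B_def\<close>)
        finally show ?thesis .
      qed
      then show ?thesis by (subst x) (auto intro!: span_sum)
    qed
    then show False
      using inf \<open>finite I\<close> by (metis B_def UNIV_eq_I finite_UnI finite_imageI)
  qed
  define e where "e = f \<circ> enumerate I"
  have en: "enumerate I i \<in> I" for i
    using \<open>infinite I\<close> by (rule enumerate_in_set)
  have "orthonormal_or_zero e"
    using f(1) inj_enumerate[OF \<open>infinite I\<close>] by (auto simp: orthonormal_or_zero_def e_def inj_def)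
  moreover have "norm (e i) = 1" for i
    using f(1) en[of i] by (auto simp: orthonormal_or_zero_def e_def I_def)
  moreover have "range f \<subseteq> insert 0 (range e)"
  proof -
    have "range e = f ` I"
      using range_enumerate[OF \<open>infinite I\<close>] by (metis e_def image_comp)
    then show ?thesis by (auto simp: I_def)
  qed
  ultimately show ?thesis
    using f by blast
qed

section \<open>Complex-linear operators\<close>

lemma blinfun_apply_cscaleL [simp]:
  "blinfun_apply (cscaleL c (T :: 'a::real_normed_vector \<Rightarrow>\<^sub>L 'b::complex_hilbert)) u = c *\<^sub>C blinfun_apply T u"
  unfolding cscaleL_def
  by (rule fun_cong[OF bounded_linear_Blinfun_apply])
     (rule bounded_linear_compose[OF bounded_linear_cscale blinfun.bounded_linear_right])

lemma blinfun_apply_zL: "blinfun_apply (zL T z) x = (\<Sum>k\<in>UNIV. (z $ k) *\<^sub>C blinfun_apply (T k) x)"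
  by (simp add: zL_def blinfun.sum_left)

lemma clinear_opD: "clinear_op T \<Longrightarrow> blinfun_apply T (c *\<^sub>C x) = c *\<^sub>C blinfun_apply T x"
  by (simp add: clinear_op_def)

lemma clinear_op_compose: "clinear_op A \<Longrightarrow> clinear_op B \<Longrightarrow> clinear_op (A o\<^sub>L B)"
  by (simp add: clinear_op_def)

lemma clinear_op_id: "clinear_op id_blinfun"
  by (simp add: clinear_op_def)

lemma clinear_op_zero: "clinear_op 0"
  by (simp add: clinear_op_def)

lemma clinear_op_scaleR: "clinear_op A \<Longrightarrow> clinear_op (r *\<^sub>R A)"
  by (simp add: clinear_op_def blinfun.scaleR_left cscale_scaleR)

lemma clinear_op_sum: "(\<And>i. i \<in> I \<Longrightarrow> clinear_op (A i)) \<Longrightarrow> clinear_op (sum A I)"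
  by (simp add: clinear_op_def blinfun.sum_left cscale_sum_right)

lemma clinear_op_zL: "(\<And>k. clinear_op (T k)) \<Longrightarrow> clinear_op (zL T z)"
  by (simp add: clinear_op_def blinfun_apply_zL cscale_sum_right cscale_cscale mult.commute)

lemma clinear_op_opprod: "(\<And>i. clinear_op (A i)) \<Longrightarrow> clinear_op (opprod A n)"
  by (induction n) (auto intro: clinear_op_id clinear_op_compose)

lemma clinear_op_sums:
  assumes "A sums B" "\<And>n. clinear_op (A n)"
  shows "clinear_op B"
  unfolding clinear_op_def
proof (intro allI)
  fix c x
  have s: "(\<lambda>n. blinfun_apply (A n) x) sums blinfun_apply B x" for x
    by (rule bounded_linear.sums[OF blinfun.bounded_linear_left assms(1)])
  have "(\<lambda>n. blinfun_apply (A n) (c *\<^sub>C x)) sums (c *\<^sub>C blinfun_apply B x)"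
    using bounded_linear.sums[OF bounded_linear_cscale s] assms(2) by (simp add: clinear_opD)
  then show "blinfun_apply B (c *\<^sub>C x) = c *\<^sub>C blinfun_apply B x"
    using s sums_unique2 by blast
qed

section \<open>Shift operators\<close>

text \<open>
  The index set of an orthonormal basis is split into infinitely long pieces, one for each \<open>V k\<close> and
  one for \<open>J\<close>, by encoding pairs in \<open>'n option \<times> nat\<close> as natural numbers.
\<close>

lemma ex_shift_operators:
  fixes \<rho> :: real
  assumes sepY: "separable_space (euclidean :: 'y::complex_hilbert topology)"
    and sepH: "separable_space (euclidean :: 'h::complex_hilbert topology)"
    and infH: "\<not> (\<exists>B. finite B \<and> span B = (UNIV :: 'h set))"
    and \<rho>: "\<rho> > 0"
  shows "\<exists>(V :: 'n::finite \<Rightarrow> 'h \<Rightarrow>\<^sub>L 'h) (S :: 'n \<Rightarrow> 'h \<Rightarrow>\<^sub>L 'h) (J :: 'y \<Rightarrow>\<^sub>L 'h) (C :: 'h \<Rightarrow>\<^sub>L 'y).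
    (\<forall>k. clinear_op (V k)) \<and> (\<forall>k. clinear_op (S k)) \<and> clinear_op J \<and> clinear_op C \<and>
    (\<forall>k. norm (V k) \<le> \<rho>) \<and> norm J \<le> 1 \<and>
    C o\<^sub>L J = id_blinfun \<and> (\<forall>k l. S k o\<^sub>L V l = (if k = l then id_blinfun else 0)) \<and>
    (\<forall>k. S k o\<^sub>L J = 0) \<and> (\<forall>k. C o\<^sub>L V k = 0)"
proof -
  obtain f :: "nat \<Rightarrow> 'y" where f: "orthonormal_or_zero f" "total_seq f"
    using ex_total_orthonormal_or_zero[OF sepY] by blast
  obtain e g :: "nat \<Rightarrow> 'h" where e: "orthonormal_or_zero e" "\<And>i. norm (e i) = 1"
    and g: "total_seq g" "range g \<subseteq> insert 0 (range e)"
    using ex_orthonormal_basis[OF sepH infH] by blast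
  define s :: "'n option \<Rightarrow> nat \<Rightarrow> nat" where "s p i = to_nat (p, i)" for p i
  have s_eq: "s p i = s q j \<longleftrightarrow> p = q \<and> i = j" for p q i j
    by (simp add: s_def)
  define E where "E p i = e (s p i)" for p i
  have E: "orthonormal_or_zero (E p)" for p
    using e(1) by (auto simp: orthonormal_or_zero_def E_def s_eq)
  have nE: "norm (E p i) = 1" for p i
    by (simp add: E_def e)
  have E_perp: "cinner (E p i) (E q j) = 0" if "p \<noteq> q" for p q i j
    using e(1) that by (auto simp: orthonormal_or_zero_def E_def s_eq)
  \<comment> \<open>Each vector of the total family \<open>g\<close> is 0 or some
    \<open>e i\<close>, so complex-linear operators are determined by their values on
    \<open>e\<close>.\<close>
  have eqH: "A = B" if "clinear_op A" "clinear_op B" "\<And>i. blinfun_apply A (e i) = blinfun_apply B (e i)"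
    for A B :: "'h \<Rightarrow>\<^sub>L 'z::complex_hilbert"
  proof (rule clinear_op_eqI[OF g(1) that(1,2)])
    fix j
    have "g j = 0 \<or> (\<exists>i. g j = e i)"
      using g(2) by auto
    then show "blinfun_apply A (g j) = blinfun_apply B (g j)"
      using that(3) by auto
  qed
  define V where "V k = partial_isom e (E (Some k))" for k
  define S where "S k = partial_isom (E (Some k)) e" for k
  define J where "J = partial_isom f (E None)"
  define C where "C = partial_isom (E None) f"
  have lin: "clinear_op (V k)" "clinear_op (S k)" "clinear_op J" "clinear_op C" for k
    by (auto simp: V_def S_def J_def C_def intro!: clinear_op_partial_isom E e f)
  have V: "blinfun_apply (V k) (e i) = E (Some k) i" for k i
    unfolding V_def by (rule partial_isom_eq[OF e(1) E e(2)])
  \<comment> \<open>The family \<open>f\<close> may contain zeros while \<open>E None\<close> does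
    not. Since \<open>J\<close> sends such an \<open>f i\<close> to 0, \<open>C o\<^sub>L J\<close>
    still fixes every \<open>f i\<close>.\<close>
  have J: "blinfun_apply J (f i) = (if f i = 0 then 0 else E None i)" for i
    using f(1) by (auto simp: J_def orthonormal_or_zero_def intro!: partial_isom_eq[OF f(1) E])
  have "C o\<^sub>L J = id_blinfun"
    by (rule clinear_op_eqI[OF f(2)])
       (auto simp: J C_def partial_isom_eq[OF E f(1) nE] intro!: clinear_op_compose clinear_op_id lin[unfolded C_def])
  moreover have "S k o\<^sub>L V l = (if k = l then id_blinfun else 0)" for k l
    by (rule eqH)
       (auto simp: V S_def partial_isom_eq[OF E e(1) nE] E_perp
         intro!: clinear_op_compose clinear_op_id clinear_op_zero lin[unfolded S_def] partial_isom_eq_0[OF E e(1)])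
  moreover have "S k o\<^sub>L J = 0" for k
    by (rule clinear_op_eqI[OF f(2)])
       (auto simp: J S_def E_perp
         intro!: clinear_op_compose clinear_op_zero lin[unfolded S_def] partial_isom_eq_0[OF E e(1)])
  moreover have "C o\<^sub>L V k = 0" for k
    by (rule eqH)
       (auto simp: V C_def E_perp
         intro!: clinear_op_compose clinear_op_zero lin[unfolded C_def] partial_isom_eq_0[OF E f(1)])
  moreover have "norm J \<le> 1" "norm (V k) \<le> 1" for k
    by (auto simp: J_def V_def intro!: norm_partial_isom_le E e f)
  \<comment> \<open>Scaling \<open>V k\<close> by \<open>\<rho>\<close> and \<open>S k\<close> by
    its inverse preserves all the relations, while words in the \<open>V k\<close> now decay like
    powers of \<open>\<rho>\<close>.\<close>
  ultimately show ?thesis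
    using \<rho> lin
    by (intro exI[of _ "\<lambda>k. \<rho> *\<^sub>R V k"] exI[of _ "\<lambda>k. inverse \<rho> *\<^sub>R S k"] exI[of _ J] exI[of _ C])
       (auto simp: clinear_op_scaleR 
         bounded_bilinear.scaleR_left[OF bounded_bilinear_blinfun_compose]
         bounded_bilinear.scaleR_right[OF bounded_bilinear_blinfun_compose] mult_left_le)
qed

text \<open>In the Fock space picture this places a vector at the position indexed by the word; the
  vacuum copy \<open>J\<close> is the empty word.\<close>

primrec word_op :: "('n \<Rightarrow> 'h::real_normed_vector \<Rightarrow>\<^sub>L 'h) \<Rightarrow> ('y::real_normed_vector \<Rightarrow>\<^sub>L 'h) \<Rightarrow> 'n list \<Rightarrow> 'y \<Rightarrow>\<^sub>L 'h" where
  "word_op V J [] = J"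
| "word_op V J (k # w) = V k o\<^sub>L word_op V J w"

lemma clinear_op_word_op:
  "(\<And>k. clinear_op (V k)) \<Longrightarrow> clinear_op J \<Longrightarrow> clinear_op (word_op V J w)"
  by (induction w) (auto intro: clinear_op_compose)

lemma norm_word_op_le:
  assumes "\<And>k. norm (V k) \<le> \<rho>" "norm J \<le> 1" "\<rho> \<ge> 0"
  shows "norm (word_op V J w) \<le> \<rho> ^ length w"
proof (induction w)
  case (Cons k w)
  have "norm (word_op V J (k # w)) \<le> norm (V k) * norm (word_op V J w)"
    by (simp add: norm_blinfun_compose)
  also have "\<dots> \<le> \<rho> * \<rho> ^ length w"
    using assms Cons by (intro mult_mono) auto
  finally show ?case by simp
qed (use assms in simp)

text \<open>Each factor \<open>zL S z\<close> strips the leading letter k and multiplies by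
  \<open>z $ k\<close>. If the word runs out early, \<open>S k\<close> kills the range of
  \<open>J\<close>; if letters remain, \<open>C\<close> kills the range of \<open>V k\<close>; only
  at equal length does \<open>C o\<^sub>L J\<close> return the vector. The last factor of
  \<open>opprod\<close> acts first, matching the head of the list.\<close>

lemma opprod_word_op:
  fixes S V :: "'n::finite \<Rightarrow> 'h::complex_hilbert \<Rightarrow>\<^sub>L 'h" and C :: "'h \<Rightarrow>\<^sub>L 'y::complex_hilbert"
  assumes lin: "\<And>k. clinear_op (S k)" "clinear_op C"
    and rel: "C o\<^sub>L J = id_blinfun" "\<And>k l. S k o\<^sub>L V l = (if k = l then id_blinfun else 0)"
      "\<And>k. S k o\<^sub>L J = 0" "\<And>k. C o\<^sub>L V k = 0"
  shows "blinfun_apply C (blinfun_apply (opprod (\<lambda>_. zL S z) n) (blinfun_apply (word_op V J w) y)) =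
    (if length w = n then prod_list (map (($) z) w) *\<^sub>C y else 0)"
proof (induction n arbitrary: w)
  case 0
  show ?case
  proof (cases w)
    case Nil
    then show ?thesis
      using rel(1) by (simp add: cscale_one) (metis blinfun_apply_blinfun_compose blinfun_apply_id_blinfun id_apply)
  next
    case (Cons k v)
    then show ?thesis
      using rel(4) by simp (metis blinfun_apply_blinfun_compose zero_blinfun.rep_eq)
  qed
next
  case (Suc n)
  show ?case
  proof (cases w)
    case Nil
    have "blinfun_apply (S k) (blinfun_apply J y) = 0" for k
      using rel(3) by (metis blinfun_apply_blinfun_compose zero_blinfun.rep_eq)
    then show ?thesis
      using Nil by (simp add: blinfun_apply_zL blinfun.zero_right)
  next
    case (Cons k v)
    have SV: "blinfun_apply (S l) (blinfun_apply (V k) x) = (if l = k then x else 0)" for l x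
      using rel(2)[of l k] by (metis blinfun_apply_blinfun_compose blinfun_apply_id_blinfun id_apply zero_blinfun.rep_eq)
    have "blinfun_apply (zL S z) (blinfun_apply (V k) x) = (z $ k) *\<^sub>C x" for x
      by (simp add: blinfun_apply_zL SV if_distrib[of "\<lambda>u. _ *\<^sub>C u"] cong: if_cong)
    then show ?thesis
      using Suc[of v] Cons lin
      by (auto simp: clinear_opD clinear_op_opprod clinear_op_zL cscale_cscale blinfun.zero_right)
  qed
qed

section \<open>The Neumann series\<close>

text \<open>\<open>opprod\<close> of a constant family is the n-th power, so for small
  \<open>E\<close> this is the inverse of \<open>id_blinfun - E\<close>.\<close>

definition neumann :: "('h::banach \<Rightarrow>\<^sub>L 'h) \<Rightarrow> 'h \<Rightarrow>\<^sub>L 'h" where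
  "neumann E = (\<Sum>n. opprod (\<lambda>_. E) n)"

lemma opprod_commute: "E o\<^sub>L opprod (\<lambda>_. E) n = opprod (\<lambda>_. E) n o\<^sub>L E"
proof (induction n)
  case (Suc n)
  then have "blinfun_apply E (blinfun_apply (opprod (\<lambda>_. E) n) x)
      = blinfun_apply (opprod (\<lambda>_. E) n) (blinfun_apply E x)" for x
    by (metis blinfun_apply_blinfun_compose)
  then show ?case by (auto intro: blinfun_eqI)
qed (auto intro: blinfun_eqI)

lemma norm_opprod_le: "norm (opprod (\<lambda>_. E) n) \<le> norm E ^ n"
proof (induction n)
  case 0
  show ?case by (auto intro!: norm_blinfun_bound)
next
  case (Suc n)
  have "norm (opprod (\<lambda>_. E) (Suc n)) \<le> norm (opprod (\<lambda>_. E) n) * norm E"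
    by (simp add: norm_blinfun_compose)
  also have "\<dots> \<le> norm E ^ n * norm E"
    using Suc by (intro mult_right_mono) auto
  finally show ?case by (simp add: mult.commute)
qed

context
  fixes E :: "'h::banach \<Rightarrow>\<^sub>L 'h"
  assumes E: "norm E \<le> 1/2"
begin

lemma norm_opprod_le_half: "norm (opprod (\<lambda>_. E) n) \<le> (1/2) ^ n"
  using norm_opprod_le[of E n] power_mono[OF E norm_ge_zero, of n] by linarith

lemma neumann_sums: "opprod (\<lambda>_. E) sums neumann E"
  unfolding neumann_def
  by (rule summable_sums, rule summable_comparison_test'[of "\<lambda>n. (1/2) ^ n" 0])
     (use norm_opprod_le_half in \<open>auto intro: summable_geometric\<close>)

lemma norm_neumann_le: "norm (neumann E) \<le> 2"
proof -
  have "norm (neumann E) \<le> (\<Sum>n. (1/2) ^ n :: real)"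
    unfolding neumann_def by (intro norm_suminf_le norm_opprod_le_half summable_geometric) simp
  then show ?thesis by (simp add: suminf_geometric)
qed

lemma neumann_compose: "neumann E o\<^sub>L E = neumann E - id_blinfun"
proof -
  have "(\<lambda>n. opprod (\<lambda>_. E) n o\<^sub>L E) sums (neumann E o\<^sub>L E)"
    by (rule bounded_linear.sums[OF bounded_bilinear.bounded_linear_left[OF bounded_bilinear_blinfun_compose] neumann_sums])
  \<comment> \<open>Composing with \<open>E\<close> raises the index by one, so the series loses
    exactly its term of index 0, the identity.\<close>
  moreover have "(\<lambda>n. opprod (\<lambda>_. E) n o\<^sub>L E) sums (neumann E - id_blinfun)"
    using neumann_sums sums_Suc_iff[of "opprod (\<lambda>_. E)"] by simp
  ultimately show ?thesis by (rule sums_unique2)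
qed

lemma compose_neumann: "E o\<^sub>L neumann E = neumann E - id_blinfun"
proof -
  have "(\<lambda>n. E o\<^sub>L opprod (\<lambda>_. E) n) sums (E o\<^sub>L neumann E)"
    by (rule bounded_linear.sums[OF bounded_bilinear.bounded_linear_right[OF bounded_bilinear_blinfun_compose] neumann_sums])
  moreover have "(\<lambda>n. E o\<^sub>L opprod (\<lambda>_. E) n) sums (neumann E - id_blinfun)"
    using neumann_sums sums_Suc_iff[of "opprod (\<lambda>_. E)"] by (simp add: opprod_commute)
  ultimately show ?thesis by (rule sums_unique2)
qed

end

lemma clinear_op_neumann: "norm E \<le> 1/2 \<Longrightarrow> clinear_op E \<Longrightarrow> clinear_op (neumann E)"
  by (rule clinear_op_sums[OF neumann_sums]) (auto intro: clinear_op_opprod)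

text \<open>The resolvent identity. On the right-hand side, \<open>neumann F\<close> absorbs
  \<open>F\<close> and \<open>neumann E\<close> absorbs \<open>E\<close>, each at the cost of an
  identity, and the mixed products cancel.\<close>

lemma neumann_diff:
  assumes "norm E \<le> 1/2" "norm F \<le> 1/2"
  shows "neumann F - neumann E = neumann F o\<^sub>L (F - E) o\<^sub>L neumann E"
proof (rule blinfun_eqI)
  fix x
  have 1: "blinfun_apply (neumann F) (blinfun_apply F y) = blinfun_apply (neumann F) y - y" for y
    using arg_cong[OF neumann_compose[OF assms(2)], of "\<lambda>T. blinfun_apply T y"]
    by (simp add: blinfun.diff_left)
  have 2: "blinfun_apply E (blinfun_apply (neumann E) x) = blinfun_apply (neumann E) x - x"
    using arg_cong[OF compose_neumann[OF assms(1)], of "\<lambda>T. blinfun_apply T x"]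
    by (simp add: blinfun.diff_left)
  show "blinfun_apply (neumann F - neumann E) x = blinfun_apply (neumann F o\<^sub>L (F - E) o\<^sub>L neumann E) x"
    by (simp add: blinfun.diff_left blinfun.diff_right 1 2)
qed

lemma bounded_linear_zL:
  fixes T :: "'n::finite \<Rightarrow> 'a::real_normed_vector \<Rightarrow>\<^sub>L 'b::complex_hilbert"
  shows "bounded_linear (zL T)"
proof (rule bounded_linear_intro[where K = "\<Sum>k\<in>UNIV. norm (T k)"])
  fix x y :: "complex^'n" and r :: real
  show "zL T (x + y) = zL T x + zL T y"
    by (rule blinfun_eqI) (simp add: blinfun_apply_zL blinfun.add_left cscale_add_left sum.distrib)
  show "zL T (r *\<^sub>R x) = r *\<^sub>R zL T x"
    by (rule blinfun_eqI)
       (simp add: blinfun_apply_zL blinfun.scaleR_left scaleR_sum_right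
         linear_scale[OF bounded_linear.linear[OF bounded_linear_cscale_left]])
  show "norm (zL T x) \<le> norm x * (\<Sum>k\<in>UNIV. norm (T k))"
  proof (rule norm_blinfun_bound)
    fix u
    have "norm (blinfun_apply (zL T x) u) \<le> (\<Sum>k\<in>UNIV. norm (x $ k) * norm (blinfun_apply (T k) u))"
      unfolding blinfun_apply_zL using norm_sum[of "\<lambda>k. x $ k *\<^sub>C blinfun_apply (T k) u" UNIV] by simp
    also have "\<dots> \<le> (\<Sum>k\<in>UNIV. norm x * (norm (T k) * norm u))"
      by (intro sum_mono mult_mono norm_blinfun Finite_Cartesian_Product.norm_nth_le) auto
    also have "\<dots> = norm x * (\<Sum>k\<in>UNIV. norm (T k)) * norm u"
      by (simp add: sum_distrib_left sum_distrib_right mult.assoc)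
    finally show "norm (blinfun_apply (zL T x) u) \<le> norm x * (\<Sum>k\<in>UNIV. norm (T k)) * norm u" .
  qed (simp add: sum_nonneg)
qed

text \<open>The resolvent identity suggests the derivative \<open>D\<close>. Used once more, it
  writes the remainder with two factors \<open>zL S (y - z)\<close>, so the remainder is quadratic.
  \<open>D\<close> commutes with \<open>\<i>\<close> because \<open>G z\<close> is
  complex-linear.\<close>

lemma cholomorphic_on_neumann:
  fixes S :: "'n::finite \<Rightarrow> 'h::complex_hilbert \<Rightarrow>\<^sub>L 'h" and T :: "'u::real_normed_vector \<Rightarrow>\<^sub>L 'h"
  assumes lin: "\<And>k. clinear_op (S k)" and "open W" and small: "\<And>z. z \<in> W \<Longrightarrow> norm (zL S z) \<le> 1/2"
  shows "cholomorphic_on (\<lambda>z. neumann (zL S z) o\<^sub>L T) W"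
  unfolding cholomorphic_on_def
proof (intro ballI exI conjI allI)
  fix z assume z: "z \<in> W"
  define G where "G z = neumann (zL S z)" for z
  define D where "D w = G z o\<^sub>L zL S w o\<^sub>L G z o\<^sub>L T" for w
  interpret zL: bounded_linear "zL S" by (rule bounded_linear_zL)
  obtain K where K: "K \<ge> 0" "\<And>w. norm (zL S w) \<le> norm w * K"
    using zL.nonneg_bounded by blast
  have bl: "bounded_linear D"
  proof -
    note bil = bounded_bilinear_blinfun_compose
    have "bounded_linear (\<lambda>w. G z o\<^sub>L zL S w)"
      by (rule bounded_linear_compose[OF bounded_bilinear.bounded_linear_right[OF bil] zL.bounded_linear_axioms])
    then show ?thesis
      unfolding D_def
      by (intro bounded_linear_compose[OF bounded_bilinear.bounded_linear_left[OF bil]])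
  qed
  obtain d where d: "d > 0" "ball z d \<subseteq> W"
    using \<open>open W\<close> z openE by blast
  have nG: "norm (G y) \<le> 2" if "y \<in> W" for y
    unfolding G_def using small[OF that] by (rule norm_neumann_le)
  show "((\<lambda>z. neumann (zL S z) o\<^sub>L T) has_derivative D) (at z)"
  proof (rule has_derivativeI_sandwich[OF d(1) bl])
    fix y assume y: "y \<in> UNIV" "y \<noteq> z" "dist y z < d"
    then have yW: "y \<in> W" using d by (auto simp: dist_commute)
    have eq: "G y - G z = G y o\<^sub>L zL S (y - z) o\<^sub>L G z"
      unfolding G_def zL.diff by (rule neumann_diff) (use small z yW in auto)
    have "(G y o\<^sub>L T) - (G z o\<^sub>L T) - D (y - z) = (G y - G z) o\<^sub>L zL S (y - z) o\<^sub>L G z o\<^sub>L T"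
    proof (rule blinfun_eqI)
      fix u
      have "blinfun_apply (G y) x - blinfun_apply (G z) x
          = blinfun_apply (G y) (blinfun_apply (zL S (y - z)) (blinfun_apply (G z) x))" for x
        using arg_cong[OF eq, of "\<lambda>T. blinfun_apply T x"] by (simp add: blinfun.diff_left)
      then show "blinfun_apply ((G y o\<^sub>L T) - (G z o\<^sub>L T) - D (y - z)) u
        = blinfun_apply ((G y - G z) o\<^sub>L zL S (y - z) o\<^sub>L G z o\<^sub>L T) u"
        by (simp only: D_def blinfun.diff_left blinfun_apply_blinfun_compose)
    qed
    also have "\<dots> = G y o\<^sub>L zL S (y - z) o\<^sub>L G z o\<^sub>L zL S (y - z) o\<^sub>L G z o\<^sub>L T"
      by (simp only: eq)
    also have "norm \<dots> \<le> norm (G y) * norm (zL S (y - z)) * norm (G z) * norm (zL S (y - z)) * norm (G z) * norm T"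
      by (intro norm_blinfun_compose[THEN order_trans] mult_right_mono) auto
    \<comment> \<open>Three resolvent factors of norm at most 2 give the constant 8, and the two
      increments give \<open>K\<^sup>2\<close> and the square of the distance.\<close>
    also have "\<dots> \<le> 2 * (norm (y - z) * K) * 2 * (norm (y - z) * K) * 2 * norm T"
      using K nG[OF yW] nG[OF z] by (intro mult_mono mult_nonneg_nonneg) auto
    finally have "norm ((G y o\<^sub>L T) - (G z o\<^sub>L T) - D (y - z)) \<le> (8 * K\<^sup>2 * norm T * norm (y - z)) * norm (y - z)"
      by (simp add: power2_eq_square mult_ac)
    then show "norm ((neumann (zL S y) o\<^sub>L T) - (neumann (zL S z) o\<^sub>L T) - D (y - z)) / norm (y - z)
        \<le> 8 * K\<^sup>2 * norm T * norm (y - z)"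
      using y by (simp add: divide_le_eq G_def)
  next
    have "((\<lambda>y. 8 * K\<^sup>2 * norm T * norm (y - z)) \<longlongrightarrow> 8 * K\<^sup>2 * norm T * norm (z - z)) (at z)"
      by (intro tendsto_intros)
    then show "((\<lambda>y. 8 * K\<^sup>2 * norm T * norm (y - z)) \<longlongrightarrow> 0) (at z)" by simp
  qed
  fix w u
  have "clinear_op (G z)"
    unfolding G_def by (intro clinear_op_neumann small z clinear_op_zL lin)
  moreover have "blinfun_apply (zL S (\<i> *s w)) x = \<i> *\<^sub>C blinfun_apply (zL S w) x" for x
    by (simp add: blinfun_apply_zL cscale_sum_right cscale_cscale)
  ultimately show "blinfun_apply (D (\<i> *s w)) u = \<i> *\<^sub>C blinfun_apply (D w) u"
    by (simp add: D_def clinear_opD)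
qed

section \<open>Coefficient estimates\<close>

text \<open>Cauchy's inequality on the unit circle. The margin R > 1 gives continuity on the closed
  disc; convergence at 1 gives a positive radius of convergence, which identifies \<open>a n\<close>
  with the Taylor coefficient of \<open>f\<close>.\<close>

lemma power_series_coeff_bound:
  fixes a :: "nat \<Rightarrow> complex"
  assumes "R > 1" and sums: "\<And>w. norm w < R \<Longrightarrow> (\<lambda>n. a n * w ^ n) sums f w"
    and bound: "\<And>w. norm w = 1 \<Longrightarrow> norm (f w) \<le> B"
  shows "norm (a n) \<le> B"
proof -
  have hol: "f holomorphic_on ball 0 R"
    by (rule power_series_holomorphic[of _ _ a]) (use sums in auto)
  have "norm ((deriv ^^ n) f 0) \<le> fact n * B / 1 ^ n"
  proof (rule Cauchy_inequality)
    show "f holomorphic_on ball 0 1"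
      using hol \<open>R > 1\<close> by (auto elim: holomorphic_on_subset)
    show "continuous_on (cball 0 1) f"
      using hol \<open>R > 1\<close> by (auto elim!: continuous_on_subset dest!: holomorphic_on_imp_continuous_on)
  qed (use bound in auto)
  moreover have "f has_fps_expansion Abs_fps a"
    unfolding has_fps_expansion_def
  proof
    have "summable (\<lambda>n. a n * 1 ^ n)"
      using sums[of 1] \<open>R > 1\<close> by (auto simp: sums_iff)
    then have "ereal (norm (1::complex)) \<le> conv_radius a"
      by (intro conv_radius_geI) auto
    moreover have "0 < ereal (norm (1::complex))"
      by simp
    ultimately have "0 < conv_radius a"
      by (rule less_le_trans[rotated])
    then show "fps_conv_radius (Abs_fps a) > 0"
      by (simp add: fps_conv_radius_def)
    have "eventually (\<lambda>z. z \<in> ball 0 R) (nhds (0::complex))"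
      using \<open>R > 1\<close> by (intro eventually_nhds_in_open) auto
    then show "eventually (\<lambda>z. eval_fps (Abs_fps a) z = f z) (nhds 0)"
      by eventually_elim (use sums in \<open>auto simp: eval_fps_def sums_iff\<close>)
  qed
  then have "a n = (deriv ^^ n) f 0 / fact n"
    using fps_nth_fps_expansion[of f "Abs_fps a" n] by simp
  ultimately show ?thesis
    by (simp add: norm_divide divide_le_eq mult.commute)
qed

lemma finite_multi_indices: "finite {\<alpha> :: 'n::finite \<Rightarrow> nat. sum \<alpha> UNIV = n}"
proof (rule finite_subset)
  show "{\<alpha> :: 'n \<Rightarrow> nat. sum \<alpha> UNIV = n} \<subseteq> PiE UNIV (\<lambda>_. {..n})"
    by (auto simp: PiE_def member_le_sum)
qed (auto intro: finite_PiE)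

text \<open>For distinct a, b below K the ratio is a K-th root of unity different from 1, because
  the powers of \<open>\<omega>\<close> below K are distinct; the geometric sum then
  vanishes.\<close>

lemma roots_of_unity_orthogonal:
  fixes K a b :: nat
  assumes "a < K" "b < K" and \<omega>: "\<omega> = cis (2 * pi / real K)"
  shows "(\<Sum>j<K. (\<omega> ^ b * inverse \<omega> ^ a) ^ j) = (if a = b then of_nat K else 0)"
proof -
  have pow: "\<omega> ^ j = cis (2 * pi * real j / real K)" for j
  proof -
    have "real j * (2 * pi / real K) = 2 * pi * real j / real K" by simp
    then show ?thesis by (simp only: \<omega> Complex.DeMoivre)
  qed
  have nz: "\<omega> \<noteq> 0" by (simp add: \<omega>)
  have 1: "\<omega> ^ K = 1"
    using assms(1) by (simp add: pow)
  show ?thesis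
  proof (cases "a = b")
    case True
    then show ?thesis using nz by (simp add: power_inverse)
  next
    case False
    have "inj_on (\<lambda>j. \<omega> ^ j) {..<K}"
      unfolding pow using Complex.bij_betw_roots_unity[of K] assms(1) by (auto simp: bij_betw_def)
    then have "\<omega> ^ b \<noteq> \<omega> ^ a"
      using assms(1,2) False by (auto simp: inj_on_def)
    then have "\<omega> ^ b * inverse \<omega> ^ a \<noteq> 1"
      using nz by (metis inverse_inverse_eq inverse_unique mult.commute power_inverse)
    moreover have "(\<omega> ^ b * inverse \<omega> ^ a) ^ K = 1"
    proof -
      have "(\<omega> ^ j) ^ K = 1" for j
        using 1 by (metis mult.commute power_mult power_one)
      then show ?thesis
        by (simp add: power_mult_distrib power_inverse)
    qed
    ultimately show ?thesis using False by (simp add: geometric_sum)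
  qed
qed

text \<open>Discrete Fourier inversion: averaging over a finite grid on the torus of radius
  \<open>\<rho>\<close> takes the place of the iterated Cauchy integral and isolates one
  coefficient.\<close>

lemma polynomial_coeff_bound_torus:
  fixes c :: "('n::finite \<Rightarrow> nat) \<Rightarrow> complex"
  assumes "\<rho> > 0"
    and bound: "\<And>z :: complex^'n. (\<And>k. norm (z $ k) = \<rho>) \<Longrightarrow>
      norm (\<Sum>\<beta>\<in>{\<beta>. sum \<beta> UNIV = n}. c \<beta> * (\<Prod>k\<in>UNIV. (z $ k) ^ \<beta> k)) \<le> B"
    and \<alpha>: "sum \<alpha> UNIV = n"
  shows "norm (c \<alpha>) * \<rho> ^ n \<le> B"
proof -
  define I where "I = {\<beta> :: 'n \<Rightarrow> nat. sum \<beta> UNIV = n}"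
  have fin: "finite I" unfolding I_def by (rule finite_multi_indices)
  \<comment> \<open>Every exponent in degree n is at most n, so K = n + 1 grid points per variable
    keep different exponents apart.\<close>
  define K where "K = Suc n"
  define \<omega> where "\<omega> = cis (2 * pi / real K)"
  have n\<omega>: "norm \<omega> = 1" by (simp add: \<omega>_def)
  define Q where "Q = PiE (UNIV :: 'n set) (\<lambda>_. {..<K})"
  have lt: "\<beta> k < K" if "\<beta> \<in> I" for \<beta> k
    using that member_le_sum[of k UNIV \<beta>] by (auto simp: I_def K_def)
  define p where "p z = (\<Sum>\<beta>\<in>I. c \<beta> * (\<Prod>k\<in>UNIV. (z $ k) ^ \<beta> k))" for z :: "complex^'n"
  define z where "z g = (\<chi> k. of_real \<rho> * \<omega> ^ g k)" for g :: "'n \<Rightarrow> nat"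
  \<comment> \<open>The character conjugate to the monomial \<open>\<alpha>\<close>: weighting the
    grid values by it cancels every other monomial.\<close>
  define h where "h g = (\<Prod>k\<in>UNIV. (inverse \<omega> ^ \<alpha> k) ^ g k)" for g :: "'n \<Rightarrow> nat"
  have card: "card Q = K ^ CARD('n)"
    unfolding Q_def by (simp add: card_PiE)
  have "(\<Sum>g\<in>Q. h g * p (z g)) = (\<Sum>\<beta>\<in>I. \<Sum>g\<in>Q. h g * (c \<beta> * (\<Prod>k\<in>UNIV. (z g $ k) ^ \<beta> k)))"
    unfolding p_def sum_distrib_left by (rule sum.swap)
  also have "\<dots> = (\<Sum>\<beta>\<in>I. c \<beta> * of_real \<rho> ^ n * (if \<beta> = \<alpha> then of_nat K ^ CARD('n) else 0))"
  proof (rule sum.cong[OF refl])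
    fix \<beta> assume \<beta>: "\<beta> \<in> I"
    have "h g * (c \<beta> * (\<Prod>k\<in>UNIV. (z g $ k) ^ \<beta> k))
        = c \<beta> * of_real \<rho> ^ n * (\<Prod>k\<in>UNIV. (\<omega> ^ \<beta> k * inverse \<omega> ^ \<alpha> k) ^ g k)" for g
    proof -
      have "(\<Prod>k\<in>UNIV. (z g $ k) ^ \<beta> k) = (\<Prod>k\<in>UNIV. of_real \<rho> ^ \<beta> k) * (\<Prod>k\<in>UNIV. (\<omega> ^ \<beta> k) ^ g k)"
        by (simp add: z_def power_mult_distrib prod.distrib power_mult[symmetric] mult.commute)
      also have "(\<Prod>k\<in>UNIV. of_real \<rho> ^ \<beta> k) = (of_real \<rho> ^ n :: complex)"
        using \<beta> by (simp add: power_sum[symmetric] I_def)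
      finally show ?thesis
        by (simp add: h_def power_mult_distrib prod.distrib mult_ac)
    qed
    then have "(\<Sum>g\<in>Q. h g * (c \<beta> * (\<Prod>k\<in>UNIV. (z g $ k) ^ \<beta> k)))
        = c \<beta> * of_real \<rho> ^ n * (\<Sum>g\<in>Q. \<Prod>k\<in>UNIV. (\<omega> ^ \<beta> k * inverse \<omega> ^ \<alpha> k) ^ g k)"
      unfolding sum_distrib_left by (intro sum.cong refl)
    also have "(\<Sum>g\<in>Q. \<Prod>k\<in>UNIV. (\<omega> ^ \<beta> k * inverse \<omega> ^ \<alpha> k) ^ g k)
        = (\<Prod>k\<in>UNIV. \<Sum>j<K. (\<omega> ^ \<beta> k * inverse \<omega> ^ \<alpha> k) ^ j)"
      unfolding Q_def by (rule prod_sum_PiE[symmetric]) auto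
    also have "\<dots> = (\<Prod>k\<in>UNIV. if \<alpha> k = \<beta> k then of_nat K else 0)"
      using \<alpha> \<beta> by (intro prod.cong refl roots_of_unity_orthogonal lt \<omega>_def) (auto simp: I_def)
    also have "\<dots> = (if \<beta> = \<alpha> then of_nat K ^ CARD('n) else 0)"
      by (auto simp: fun_eq_iff)
    finally show "(\<Sum>g\<in>Q. h g * (c \<beta> * (\<Prod>k\<in>UNIV. (z g $ k) ^ \<beta> k)))
        = c \<beta> * of_real \<rho> ^ n * (if \<beta> = \<alpha> then of_nat K ^ CARD('n) else 0)" .
  qed
  also have "\<dots> = c \<alpha> * of_real \<rho> ^ n * of_nat K ^ CARD('n)"
    using fin \<alpha> by (simp add: I_def if_distrib[of "\<lambda>x. _ * x"] cong: if_cong)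
  finally have "norm (c \<alpha>) * \<rho> ^ n * real K ^ CARD('n) = norm (\<Sum>g\<in>Q. h g * p (z g))"
    using \<open>\<rho> > 0\<close> by (simp add: norm_mult norm_power)
  also have "\<dots> \<le> (\<Sum>g\<in>Q. B)"
  proof (rule sum_norm_le)
    fix g
    have "norm (p (z g)) \<le> B"
      unfolding p_def I_def using n\<omega> \<open>\<rho> > 0\<close> by (intro bound) (simp add: z_def norm_mult norm_power)
    moreover have "norm (h g) = 1"
      using n\<omega> by (simp add: h_def norm_power norm_inverse flip: prod_norm)
    ultimately show "norm (h g * p (z g)) \<le> B" by (simp add: norm_mult)
  qed
  also have "\<dots> = B * real K ^ CARD('n)"
    by (simp add: card)
  finally show ?thesis
    by (simp add: K_def)
qed

text \<open>Two Cauchy estimates after pairing with vectors u and v: the slice w \<mapsto>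
  \<open>\<theta> (w *s z)\<close> bounds each homogeneous part on a ball, then the torus estimate
  bounds its coefficients.\<close>

lemma homogeneous_coeff_bound:
  fixes A :: "nat \<Rightarrow> ('n::finite \<Rightarrow> nat) \<Rightarrow> ('u::complex_hilbert \<Rightarrow>\<^sub>L 'y::complex_hilbert)"
    and P :: "nat \<Rightarrow> complex^'n \<Rightarrow> ('u \<Rightarrow>\<^sub>L 'y)"
  assumes P: "\<And>n z. P n z = (\<Sum>\<alpha>\<in>{\<alpha>. sum \<alpha> UNIV = n}. cscaleL (\<Prod>k\<in>UNIV. (z $ k) ^ \<alpha> k) (A n \<alpha>))"
    and "r > 0" and sums: "\<And>z. norm z < r \<Longrightarrow> (\<lambda>n. P n z) sums \<theta> z"
    and bound: "\<And>z. norm z < r \<Longrightarrow> norm (\<theta> z) \<le> M"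
    and \<alpha>: "sum \<alpha> UNIV = n"
  shows "norm (A n \<alpha>) * (r / (2 * real CARD('n))) ^ n \<le> M"
proof -
  \<comment> \<open>A point whose coordinates all have modulus \<open>\<rho>\<close> has norm at
    most \<open>CARD('n)\<close> times \<open>\<rho>\<close>, that is r / 2.\<close>
  define \<rho> where "\<rho> = r / (2 * real CARD('n))"
  have "\<rho> > 0" using \<open>r > 0\<close> by (simp add: \<rho>_def)
  have hom: "blinfun_apply (P n (w *s z)) u = (w ^ n) *\<^sub>C blinfun_apply (P n z) u" for n w z u
    unfolding P blinfun.sum_left cscale_sum_right
  proof (rule sum.cong[OF refl])
    fix \<beta> :: "'n \<Rightarrow> nat" assume "\<beta> \<in> {\<beta>. sum \<beta> UNIV = n}"
    then have "(\<Prod>k\<in>UNIV. ((w *s z) $ k) ^ \<beta> k) = w ^ n * (\<Prod>k\<in>UNIV. (z $ k) ^ \<beta> k)"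
      by (auto simp: power_mult_distrib prod.distrib power_sum)
    then show "blinfun_apply (cscaleL (\<Prod>k\<in>UNIV. ((w *s z) $ k) ^ \<beta> k) (A n \<beta>)) u
      = w ^ n *\<^sub>C blinfun_apply (cscaleL (\<Prod>k\<in>UNIV. (z $ k) ^ \<beta> k) (A n \<beta>)) u"
      by (simp add: cscale_cscale)
  qed
  \<comment> \<open>The radius r / 2 leaves room for all slice parameters with modulus below 2, so
    the one-variable estimate applies with R = 2.\<close>
  have coeff: "norm (cinner v (blinfun_apply (P n z) u)) \<le> norm v * (M * norm u)" if z: "norm z \<le> r / 2" for z u v
  proof (rule power_series_coeff_bound[of 2])
    have norm_smult: "norm (w *s z) = norm w * norm z" for w :: complex
      by (simp add: norm_vec_def norm_mult L2_set_right_distrib)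
    show "(\<lambda>n. cinner v (blinfun_apply (P n z) u) * w ^ n) sums cinner v (blinfun_apply (\<theta> (w *s z)) u)"
      if "norm w < 2" for w
    proof -
      have "norm (w *s z) < r"
      proof -
        have "norm w * norm z \<le> norm w * (r / 2)"
          using z by (intro mult_left_mono) auto
        also have "\<dots> < 2 * (r / 2)"
          using that \<open>r > 0\<close> by (intro mult_strict_right_mono) auto
        finally show ?thesis by (simp add: norm_smult)
      qed
      then have "(\<lambda>n. cinner v (blinfun_apply (P n (w *s z)) u)) sums cinner v (blinfun_apply (\<theta> (w *s z)) u)"
        by (intro bounded_linear.sums[OF bounded_linear_cinner_right]
            bounded_linear.sums[OF blinfun.bounded_linear_left] sums)
      then show ?thesis
        by (simp add: hom cinner_cscale_right mult.commute)
    qed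
    fix w :: complex assume "norm w = 1"
    then have "norm (w *s z) < r"
      using z \<open>r > 0\<close> norm_smult[of w] by simp
    then have "norm (blinfun_apply (\<theta> (w *s z)) u) \<le> M * norm u"
      using norm_blinfun[of "\<theta> (w *s z)" u] bound by (meson mult_right_mono norm_ge_zero order_trans)
    then show "norm (cinner v (blinfun_apply (\<theta> (w *s z)) u)) \<le> norm v * (M * norm u)"
      using norm_cinner_le[of v] by (meson mult_left_mono norm_ge_zero order_trans)
  qed simp
  have torus: "norm (cinner v (blinfun_apply (A n \<alpha>) u)) * \<rho> ^ n \<le> norm v * (M * norm u)" for u v
  proof (rule polynomial_coeff_bound_torus[OF \<open>\<rho> > 0\<close> _ \<alpha>])
    fix z :: "complex^'n" assume z: "\<And>k. norm (z $ k) = \<rho>"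
    have "norm z \<le> (\<Sum>k\<in>UNIV. norm (z $ k))"
      unfolding norm_vec_def by (rule L2_set_le_sum) simp
    also have "\<dots> = r / 2"
      using z by (simp add: \<rho>_def)
    finally have "norm (cinner v (blinfun_apply (P n z) u)) \<le> norm v * (M * norm u)"
      by (rule coeff)
    then show "norm (\<Sum>\<beta>\<in>{\<beta>. sum \<beta> UNIV = n}. cinner v (blinfun_apply (A n \<beta>) u) * (\<Prod>k\<in>UNIV. (z $ k) ^ \<beta> k))
        \<le> norm v * (M * norm u)"
      by (simp add: P blinfun.sum_left cinner_sum_right cinner_cscale_right mult.commute)
  qed
  have M: "M \<ge> 0"
    using bound[of 0] \<open>r > 0\<close> by (metis norm_ge_zero norm_zero order_trans)
  have "norm (A n \<alpha>) \<le> M / \<rho> ^ n"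
  proof (rule norm_blinfun_bound)
    fix u
    \<comment> \<open>Pairing the image with itself turns the scalar estimate into a norm estimate,
      after one factor \<open>norm v\<close> is cancelled.\<close>
    define v where "v = blinfun_apply (A n \<alpha>) u"
    have "norm v * (norm v * \<rho> ^ n) \<le> norm v * (M * norm u)"
      using torus[of v u] by (simp add: v_def cinner_self power2_eq_square norm_mult mult.assoc)
    then have "norm v * \<rho> ^ n \<le> M * norm u"
      using M by (cases "v = 0") auto
    then show "norm (blinfun_apply (A n \<alpha>) u) \<le> M / \<rho> ^ n * norm u"
      using \<open>\<rho> > 0\<close> by (simp add: v_def field_simps)
  qed (use M \<open>\<rho> > 0\<close> in simp)
  then have "norm (A n \<alpha>) * \<rho> ^ n \<le> M"
    using \<open>\<rho> > 0\<close> by (simp add: pos_le_divide_eq)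
  then show ?thesis
    by (simp only: \<rho>_def)
qed

section \<open>Multi-indices as words and the realization of the coefficients\<close>

lemma ex_word_of_multi_index:
  fixes \<alpha> :: "'n::finite \<Rightarrow> nat"
  shows "\<exists>w. count_list w = \<alpha>"
proof -
  obtain w where "mset w = Abs_multiset \<alpha>"
    using ex_mset by blast
  then have "count (mset w) = \<alpha>"
    by (simp add: Abs_multiset_inverse)
  then show ?thesis
    by (intro exI[of _ w]) (simp add: fun_eq_iff count_mset)
qed

lemma prod_list_map_count_list:
  fixes f :: "'n::finite \<Rightarrow> 'a::comm_monoid_mult"
  shows "prod_list (map f w) = (\<Prod>k\<in>UNIV. f k ^ count_list w k)"
proof (induction w)
  case (Cons a w)
  have "(\<Prod>k\<in>UNIV. f k ^ count_list (a # w) k) = (\<Prod>k\<in>UNIV. (if k = a then f k else 1) * f k ^ count_list w k)"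
    by (intro prod.cong) auto
  then show ?case
    by (simp add: Cons prod.distrib)
qed simp

text \<open>Every multi-index of degree n counts the letters of some word of length n. This crude
  bound suffices for a geometric series.\<close>

lemma card_multi_indices_le: "card {\<alpha> :: 'n::finite \<Rightarrow> nat. sum \<alpha> UNIV = n} \<le> CARD('n) ^ n"
proof -
  define L where "L = {w :: 'n list. set w \<subseteq> UNIV \<and> length w = n}"
  have "{\<alpha> :: 'n \<Rightarrow> nat. sum \<alpha> UNIV = n} \<subseteq> count_list ` L"
  proof
    fix \<alpha> :: "'n \<Rightarrow> nat" assume \<alpha>: "\<alpha> \<in> {\<alpha>. sum \<alpha> UNIV = n}"
    obtain w where w: "count_list w = \<alpha>" using ex_word_of_multi_index by blast
    then have "w \<in> L" using \<alpha> List.sum_count_set[of w UNIV] by (auto simp: L_def)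
    then show "\<alpha> \<in> count_list ` L" using w by blast
  qed
  then have "card {\<alpha> :: 'n \<Rightarrow> nat. sum \<alpha> UNIV = n} \<le> card L"
  proof (rule surj_card_le[rotated])
    show "finite L"
      unfolding L_def by (rule finite_lists_length_eq) simp
  qed
  also have "card L = CARD('n) ^ n"
    unfolding L_def by (rule card_lists_length_eq) simp
  finally show ?thesis .
qed

text \<open>\<open>T\<close> stores each coefficient \<open>A n \<alpha>\<close> at one word with
  letter counts \<open>\<alpha>\<close>. Applying n factors \<open>zL S z\<close> and then
  \<open>C\<close> retrieves exactly the words of length n, each weighted by its monomial.\<close>

lemma ex_realization:
  fixes A :: "nat \<Rightarrow> ('n::finite \<Rightarrow> nat) \<Rightarrow> ('u::complex_hilbert \<Rightarrow>\<^sub>L 'y::complex_hilbert)"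
  assumes sepY: "separable_space (euclidean :: 'y topology)"
    and sepH: "separable_space (euclidean :: 'h::complex_hilbert topology)"
    and infH: "\<not> (\<exists>B. finite B \<and> span B = (UNIV :: 'h set))"
    and lin: "\<And>n \<alpha>. clinear_op (A n \<alpha>)"
    and "\<rho> > 0" and bound: "\<And>n \<alpha>. sum \<alpha> UNIV = n \<Longrightarrow> norm (A n \<alpha>) * \<rho> ^ n \<le> M"
  shows "\<exists>(S :: 'n \<Rightarrow> 'h::complex_hilbert \<Rightarrow>\<^sub>L 'h) (C :: 'h \<Rightarrow>\<^sub>L 'y) (T :: 'u \<Rightarrow>\<^sub>L 'h).
    (\<forall>k. clinear_op (S k)) \<and> clinear_op C \<and> clinear_op T \<and>
    (\<forall>n z. C o\<^sub>L opprod (\<lambda>_. zL S z) n o\<^sub>L T =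
      (\<Sum>\<alpha>\<in>{\<alpha>. sum \<alpha> UNIV = n}. cscaleL (\<Prod>k\<in>UNIV. (z $ k) ^ \<alpha> k) (A n \<alpha>)))"
proof -
  \<comment> \<open>The weight \<sigma>^n compensates both the factor 1 / \<rho>^n in the
    coefficient bound and the at most \<open>CARD('n) ^ n\<close> multi-indices, leaving M
    (1/2)^n.\<close>
  define \<sigma> where "\<sigma> = \<rho> / (2 * real CARD('n))"
  have \<sigma>: "\<sigma> > 0" using \<open>\<rho> > 0\<close> by (simp add: \<sigma>_def)
  obtain V S :: "'n \<Rightarrow> 'h \<Rightarrow>\<^sub>L 'h" and J :: "'y \<Rightarrow>\<^sub>L 'h" and C :: "'h \<Rightarrow>\<^sub>L 'y" where
    cl: "\<And>k. clinear_op (V k)" "\<And>k. clinear_op (S k)" "clinear_op J" "clinear_op C"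
    and nrm: "\<And>k. norm (V k) \<le> \<sigma>" "norm J \<le> 1"
    and rel: "C o\<^sub>L J = id_blinfun" "\<And>k l. S k o\<^sub>L V l = (if k = l then id_blinfun else 0)"
      "\<And>k. S k o\<^sub>L J = 0" "\<And>k. C o\<^sub>L V k = 0"
    using ex_shift_operators[OF sepY sepH infH \<sigma>, where 'n = 'n] by blast
  \<comment> \<open>The scalars \<open>z $ k\<close> commute, so any single word with the right
    letter counts can represent a multi-index.\<close>
  define wd :: "('n \<Rightarrow> nat) \<Rightarrow> 'n list" where "wd \<alpha> = (SOME w. count_list w = \<alpha>)" for \<alpha>
  have wd: "count_list (wd \<alpha>) = \<alpha>" for \<alpha>
    unfolding wd_def by (rule someI_ex[OF ex_word_of_multi_index])
  have len: "length (wd \<alpha>) = sum \<alpha> UNIV" for \<alpha>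
    using List.sum_count_set[of "wd \<alpha>" UNIV] by (simp add: wd)
  define I where "I n = {\<alpha> :: 'n \<Rightarrow> nat. sum \<alpha> UNIV = n}" for n
  define T where "T n = (\<Sum>\<alpha>\<in>I n. word_op V J (wd \<alpha>) o\<^sub>L A n \<alpha>)" for n
  have T_lin: "clinear_op (T n)" for n
    unfolding T_def by (intro clinear_op_sum clinear_op_compose clinear_op_word_op cl lin)
  have "M \<ge> 0"
    using bound[of "\<lambda>_. 0" 0] by (auto intro: order_trans[OF norm_ge_zero])
  have T_norm: "norm (T n) \<le> M * (1/2) ^ n" for n
  proof -
    have "norm (word_op V J (wd \<alpha>) o\<^sub>L A n \<alpha>) \<le> \<sigma> ^ n * (M / \<rho> ^ n)" if "\<alpha> \<in> I n" for \<alpha>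
    proof -
      have "norm (A n \<alpha>) \<le> M / \<rho> ^ n"
        using bound[of \<alpha> n] that \<open>\<rho> > 0\<close> by (simp add: I_def field_simps)
      moreover have "norm (word_op V J (wd \<alpha>)) \<le> \<sigma> ^ n"
        using norm_word_op_le[of V \<sigma> J "wd \<alpha>"] nrm that \<sigma> by (simp add: len I_def)
      ultimately show ?thesis
        using \<sigma> by (intro norm_blinfun_compose[THEN order_trans] mult_mono) auto
    qed
    then have "norm (T n) \<le> of_nat (card (I n)) * (\<sigma> ^ n * (M / \<rho> ^ n))"
      unfolding T_def by (rule sum_norm_bound)
    also have "\<dots> \<le> real CARD('n) ^ n * (\<sigma> ^ n * (M / \<rho> ^ n))"
      using card_multi_indices_le[where 'n = 'n, of n] \<sigma> \<open>M \<ge> 0\<close> \<open>\<rho> > 0\<close>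
      by (intro mult_right_mono) (auto simp: I_def simp flip: of_nat_power)
    also have "\<dots> = M * (1/2) ^ n"
      using \<open>\<rho> > 0\<close> by (simp add: \<sigma>_def power_divide power_mult_distrib)
    finally show ?thesis .
  qed
  have "summable T"
    by (rule summable_comparison_test'[of "\<lambda>n. M * (1/2) ^ n" 0])
       (use T_norm in \<open>auto intro!: summable_mult summable_geometric\<close>)
  then have T_sums: "T sums suminf T" by (rule summable_sums)
  have "C o\<^sub>L opprod (\<lambda>_. zL S z) n o\<^sub>L suminf T =
      (\<Sum>\<alpha>\<in>I n. cscaleL (\<Prod>k\<in>UNIV. (z $ k) ^ \<alpha> k) (A n \<alpha>))" for n z
  proof (rule blinfun_eqI)
    fix u
    define Q where "Q = C o\<^sub>L opprod (\<lambda>_. zL S z) n"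
    have Q_word: "blinfun_apply Q (blinfun_apply (word_op V J w) y) =
        (if length w = n then prod_list (map (($) z) w) *\<^sub>C y else 0)" for w y
      unfolding Q_def blinfun_apply_blinfun_compose by (rule opprod_word_op[OF cl(2,4) rel])
    \<comment> \<open>\<open>Q\<close> annihilates all words whose length differs from n, so the
      series for \<open>T\<close> collapses to its n-th term.\<close>
    have Q_T: "blinfun_apply Q (blinfun_apply (T l) u) =
        (if l = n then \<Sum>\<alpha>\<in>I n. (\<Prod>k\<in>UNIV. (z $ k) ^ \<alpha> k) *\<^sub>C blinfun_apply (A n \<alpha>) u else 0)" for l
    proof -
      have "blinfun_apply Q (blinfun_apply (T l) u) =
          (\<Sum>\<alpha>\<in>I l. blinfun_apply Q (blinfun_apply (word_op V J (wd \<alpha>)) (blinfun_apply (A l \<alpha>) u)))"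
        by (simp add: T_def blinfun.sum_left blinfun.sum_right)
      also have "\<dots> = (\<Sum>\<alpha>\<in>I l. if l = n then (\<Prod>k\<in>UNIV. (z $ k) ^ \<alpha> k) *\<^sub>C blinfun_apply (A n \<alpha>) u else 0)"
        unfolding Q_word by (intro sum.cong refl) (auto simp: len I_def prod_list_map_count_list wd)
      finally show ?thesis by auto
    qed
    have "(\<lambda>l. blinfun_apply Q (blinfun_apply (T l) u)) sums blinfun_apply Q (blinfun_apply (suminf T) u)"
      by (intro bounded_linear.sums[OF blinfun.bounded_linear_right]
          bounded_linear.sums[OF blinfun.bounded_linear_left] T_sums)
    moreover have "(\<lambda>l. blinfun_apply Q (blinfun_apply (T l) u)) sums
        (\<Sum>\<alpha>\<in>I n. (\<Prod>k\<in>UNIV. (z $ k) ^ \<alpha> k) *\<^sub>C blinfun_apply (A n \<alpha>) u)"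
      unfolding Q_T by (rule sums_single)
    ultimately show "blinfun_apply (C o\<^sub>L opprod (\<lambda>_. zL S z) n o\<^sub>L suminf T) u =
        blinfun_apply (\<Sum>\<alpha>\<in>I n. cscaleL (\<Prod>k\<in>UNIV. (z $ k) ^ \<alpha> k) (A n \<alpha>)) u"
      by (simp add: sums_unique2 Q_def blinfun.sum_left)
  qed
  then show ?thesis
    using cl clinear_op_sums[OF T_sums T_lin] unfolding I_def by blast
qed

section \<open>The factorization near the origin\<close>

theorem mainTheorem1:
  fixes \<theta> :: "complex^'n::finite \<Rightarrow> ('u::complex_hilbert \<Rightarrow>\<^sub>L 'y::complex_hilbert)"
    and \<Gamma> :: "(complex^'n) set"
    and m :: nat
  assumes sepU: "separable_space (euclidean :: 'u topology)"
    and sepY: "separable_space (euclidean :: 'y topology)"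
    and sepH: "separable_space (euclidean :: 'h::complex_hilbert topology)"
    and infH: "\<not> (\<exists>B. finite B \<and> span B = (UNIV :: 'h set))"
    and "open \<Gamma>" and "0 \<in> \<Gamma>"
    and "cholomorphic_on \<theta> \<Gamma>"
    and "\<forall>z\<in>\<Gamma>. clinear_op (\<theta> z)"
    and "zero_multiplicity \<theta> m" and "m > 0"
  shows "\<exists>(L1 :: 'n \<Rightarrow> ('h \<Rightarrow>\<^sub>L 'y)) (L :: nat \<Rightarrow> 'n \<Rightarrow> ('h \<Rightarrow>\<^sub>L 'h))
            (\<phi> :: complex^'n \<Rightarrow> ('u \<Rightarrow>\<^sub>L 'h)) W.
           (\<forall>k. clinear_op (L1 k)) \<and> (\<forall>j\<in>{2..m}. \<forall>k. clinear_op (L j k)) \<and>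
           open W \<and> 0 \<in> W \<and> W \<subseteq> \<Gamma> \<and>
           cholomorphic_on \<phi> W \<and> (\<forall>z\<in>W. clinear_op (\<phi> z)) \<and> \<phi> 0 \<noteq> 0 \<and>
           (\<forall>z\<in>W. \<theta> z = zL L1 z o\<^sub>L opprod (\<lambda>i. zL (L (i + 1)) z) (m - 1) o\<^sub>L \<phi> z)"
proof -
  obtain P r0 where hom: "\<And>n. hom_poly (P n) n" and "r0 > 0"
    and sums0: "\<And>z. norm z < r0 \<Longrightarrow> (\<lambda>n. P n z) sums \<theta> z"
    and low: "\<And>n z. n < m \<Longrightarrow> P n z = 0" and nz: "\<exists>z. P m z \<noteq> 0"
    using \<open>zero_multiplicity \<theta> m\<close> unfolding zero_multiplicity_def by blast
  have "\<forall>n. \<exists>A. (\<forall>\<alpha>. clinear_op (A \<alpha>)) \<and>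
      (\<forall>z. P n z = (\<Sum>\<alpha>\<in>{\<alpha>. sum \<alpha> UNIV = n}. cscaleL (\<Prod>k\<in>UNIV. (z $ k) ^ \<alpha> k) (A \<alpha>)))"
    using hom unfolding hom_poly_def by blast
  from choice[OF this] obtain A where lin: "\<And>n \<alpha>. clinear_op (A n \<alpha>)"
    and P: "\<And>n z. P n z = (\<Sum>\<alpha>\<in>{\<alpha>. sum \<alpha> UNIV = n}. cscaleL (\<Prod>k\<in>UNIV. (z $ k) ^ \<alpha> k) (A n \<alpha>))"
    by blast
  \<comment> \<open>Differentiability at 0 gives continuity there, hence the local bound on
    \<open>\<theta>\<close> that feeds the Cauchy estimates.\<close>
  obtain D where "(\<theta> has_derivative D) (at 0)"
    using \<open>cholomorphic_on \<theta> \<Gamma>\<close> \<open>0 \<in> \<Gamma>\<close> unfolding cholomorphic_on_def by blast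
  then have "isCont \<theta> 0"
    by (rule has_derivative_continuous)
  then obtain d where "d > 0" and d: "\<And>z. dist z 0 < d \<Longrightarrow> dist (\<theta> z) (\<theta> 0) < 1"
    unfolding continuous_at_eps_delta by (metis zero_less_one)
  define r where "r = min r0 d"
  have "r > 0" using \<open>r0 > 0\<close> \<open>d > 0\<close> by (simp add: r_def)
  have sums: "(\<lambda>n. P n z) sums \<theta> z" if "norm z < r" for z
    using sums0 that by (simp add: r_def)
  have bound: "norm (\<theta> z) \<le> norm (\<theta> 0) + 1" if "norm z < r" for z
    using d[of z] that norm_triangle_ineq2[of "\<theta> z" "\<theta> 0"] by (simp add: r_def dist_norm)
  have coeff: "norm (A n \<alpha>) * (r / (2 * real CARD('n))) ^ n \<le> norm (\<theta> 0) + 1" if "sum \<alpha> UNIV = n" for n \<alpha>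
    by (rule homogeneous_coeff_bound[OF P \<open>r > 0\<close> sums bound that])
  have "r / (2 * real CARD('n)) > 0"
    using \<open>r > 0\<close> by simp
  from ex_realization[where A = A, OF sepY sepH infH lin this coeff] obtain S :: "'n \<Rightarrow> 'h \<Rightarrow>\<^sub>L 'h" and C :: "'h \<Rightarrow>\<^sub>L 'y" and T :: "'u \<Rightarrow>\<^sub>L 'h" where
    cl: "\<And>k. clinear_op (S k)" "clinear_op C" "clinear_op T"
    and realization: "\<And>n z. C o\<^sub>L opprod (\<lambda>_. zL S z) n o\<^sub>L T = P n z"
    unfolding P by auto
  define \<phi> where "\<phi> z = neumann (zL S z) o\<^sub>L T" for z
  obtain K where K: "K > 0" "\<And>w. norm (zL S w) \<le> norm w * K"
    using bounded_linear.pos_bounded[OF bounded_linear_zL[of S]] by blast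
  obtain \<epsilon> where \<epsilon>: "\<epsilon> > 0" "ball 0 \<epsilon> \<subseteq> \<Gamma>"
    using \<open>open \<Gamma>\<close> \<open>0 \<in> \<Gamma>\<close> openE by blast
  \<comment> \<open>The three radii keep \<open>W\<close> inside \<open>\<Gamma>\<close>, inside the
    region of the homogeneous expansion, and where \<open>zL S z\<close> has norm at most
    1/2.\<close>
  define W where "W = ball (0::complex^'n) (min (min \<epsilon> r) (1 / (2 * K)))"
  have W: "open W" "0 \<in> W" "W \<subseteq> \<Gamma>"
    using \<epsilon> \<open>r > 0\<close> K by (auto simp: W_def)
  have small: "norm (zL S z) \<le> 1/2" if "z \<in> W" for z
  proof -
    have "norm z * K \<le> 1 / (2 * K) * K"
      using that K by (intro mult_right_mono) (auto simp: W_def)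
    then show ?thesis using K(1) K(2)[of z] by simp
  qed
  have "\<phi> 0 \<noteq> 0"
  proof
    assume "\<phi> 0 = 0"
    have "zL S 0 = 0"
      \<comment> \<open>At z = 0 the Neumann series is the identity, so \<open>\<phi> 0\<close> is
        \<open>T\<close>; if it vanished, every \<open>P n\<close> would vanish too, including
        \<open>P m\<close>.\<close>
      by (rule linear_0[OF bounded_linear.linear[OF bounded_linear_zL]])
    then have "neumann (zL S 0) = id_blinfun"
      using neumann_compose[of "zL S 0"] by simp
    moreover have "id_blinfun o\<^sub>L T = T"
      by (rule blinfun_eqI) simp
    ultimately have "T = 0"
      using \<open>\<phi> 0 = 0\<close> by (simp add: \<phi>_def)
    then have "P m z = 0" for z
      by (simp add: realization[symmetric])
    then show False using nz by blast
  qed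
  moreover have "\<theta> z = zL (\<lambda>k. C o\<^sub>L S k) z o\<^sub>L opprod (\<lambda>i. zL S z) (m - 1) o\<^sub>L \<phi> z" if z: "z \<in> W" for z
  proof (rule blinfun_eqI)
    fix u
    define E where "E = zL S z"
    have E: "norm E \<le> 1/2" unfolding E_def by (rule small[OF z])
    \<comment> \<open>The terms below m vanish, so the expansion starts at m and the common factor
      \<open>Q\<close>, the m-th power of \<open>E\<close>, can be taken out of the rest.\<close>
    have "(\<lambda>n. P (n + m) z) sums (\<theta> z - (\<Sum>n<m. P n z))"
      using sums z by (intro sums_split_initial_segment) (auto simp: W_def)
    then have 1: "(\<lambda>n. blinfun_apply (P (n + m) z) u) sums blinfun_apply (\<theta> z) u"
      using low by (auto intro: bounded_linear.sums[OF blinfun.bounded_linear_left])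
    have add: "blinfun_apply (opprod (\<lambda>_. E) (n + l)) x = blinfun_apply (opprod (\<lambda>_. E) l) (blinfun_apply (opprod (\<lambda>_. E) n) x)"
      for n l x
    proof (induction n arbitrary: x)
      case (Suc n)
      then show ?case by simp
    qed simp
    define Q where "Q = opprod (\<lambda>_. E) m"
    have "(\<lambda>n. blinfun_apply C (blinfun_apply Q (blinfun_apply (opprod (\<lambda>_. E) n) (blinfun_apply T u))))
       sums blinfun_apply C (blinfun_apply Q (blinfun_apply (neumann E) (blinfun_apply T u)))"
      by (intro bounded_linear.sums[OF blinfun.bounded_linear_right]
          bounded_linear.sums[OF blinfun.bounded_linear_left] neumann_sums E)
    moreover have "blinfun_apply C (blinfun_apply Q (blinfun_apply (opprod (\<lambda>_. E) n) (blinfun_apply T u)))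
        = blinfun_apply (P (n + m) z) u" for n
      unfolding realization[symmetric] Q_def blinfun_apply_blinfun_compose E_def[symmetric] add ..
    ultimately have 2: "blinfun_apply (\<theta> z) u = blinfun_apply C (blinfun_apply Q (blinfun_apply (\<phi> z) u))"
      using sums_unique2[OF 1] by (simp add: \<phi>_def E_def)
    obtain l where l: "m = Suc l" using \<open>m > 0\<close> by (cases m) auto
    \<comment> \<open>\<open>opprod\<close> grows on the right, so commutation of powers is needed
      to expose a leftmost \<open>E\<close>. By complex linearity \<open>C\<close> is absorbed into
      it, which yields the first factor with coefficients \<open>C o\<^sub>L S k\<close> and leaves
      m - 1 factors.\<close>
    have "Q = E o\<^sub>L opprod (\<lambda>_. E) l"
      unfolding Q_def l by (simp add: opprod_commute)
    moreover have "blinfun_apply (zL (\<lambda>k. C o\<^sub>L S k) z) x = blinfun_apply C (blinfun_apply E x)" for x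
      using cl(2) by (simp add: E_def blinfun_apply_zL blinfun.sum_right clinear_opD)
    ultimately show "blinfun_apply (\<theta> z) u
        = blinfun_apply (zL (\<lambda>k. C o\<^sub>L S k) z o\<^sub>L opprod (\<lambda>i. zL S z) (m - 1) o\<^sub>L \<phi> z) u"
      using 2 by (simp add: l E_def)
  qed
  moreover have "cholomorphic_on \<phi> W"
    unfolding \<phi>_def by (intro cholomorphic_on_neumann cl W small)
  moreover have "clinear_op (\<phi> z)" if "z \<in> W" for z
    unfolding \<phi>_def by (intro clinear_op_compose clinear_op_neumann clinear_op_zL cl small that)
  moreover have "clinear_op (C o\<^sub>L S k)" for k
    by (intro clinear_op_compose cl)
  ultimately show ?thesis
    using W cl by (intro exI[of _ "\<lambda>k. C o\<^sub>L S k"] exI[of _ "\<lambda>_. S"] exI[of _ \<phi>] exI[of _ W]) auto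
qed

end
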